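(* In each of the picking systems Pcart-N, Pcart, and Robot, the asymptotic competitive ratio of Reopt satisfies $\sigma_{asymp.}(Reopt)\le 2$. In other words, for every instance $I(n)$ with $n$ orders, $$Reopt(I(n))\le 2\cdot CIOPT(I(n))+const,$$ where $const=u=(a+1)W+2L$.
   Context: Warehouse. A warehouse is a rectilinear grid of length $L$ and width $W$ consisting of $a\ge 1$ equidistant parallel (vertical) aisles, each a segment of length $W$, and $b\ge 2$ equidistant (horizontal) cross-aisles, each a segment of length $L$; the outermost aisles and cross-aisles form the border of the grid (for $a=1$, $L=0$). The picker moves along aisles and cross-aisles at unit speed (and may wait); $d$ is the resulting shortest-path metric. The depot $l_d$ is a fixed point of the grid. Picking locations are points in aisles. Instance. An instance $I$ consists of the infrastructure ($W,L,a,b,l_d$ and the batching capacity $c\in\mathbb{N}$), a sequence of orders $o_1,\ldots,o_n$, where $o_j=\{s_j^1,\ldots,s_j^{k(j)}\}$ is a set of $k(j)\ge1$ picking locations (items), and arrival times $0\le r_1\le\ldots\le r_n$. The picker starts at $l_d$ at time 0. A solution partitions the orders into batches of at most $c$ orders, sequences the batches, and fixes for each batch a visiting sequence of all picking locations of its orders. Batches are processed one after another; an item of $o_j$ cannot be picked before $r_j$; picking itself takes zero time; an order cannot be split between batches. With a pushcart, every batch starts at the depot and ends with the picker's return to the depot, and the objective (total completion time) is the time of the final return to the depot. With a robot, the picker starts the next batch from the location where she picked the last item of the previous batch (a new empty robot is immediately available there), and the objective is the time at which the last item is picked. $CIOPT(I)$ is the minimum objective value when the whole instance is known in advance (the picker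 may then move towards locations of orders that have not arrived yet). Online policy Reopt and the three systems. Online, the number of orders is unknown and each order (with its picking locations) becomes known only at its arrival time. Reopt never anticipates future orders; when it reoptimizes at time $t$, it computes a plan with minimal total completion time for the orders that have arrived by $t$ and have not been completely picked, treating them as immediately available, and follows this plan until the next reoptimization; if there is nothing left to do, the picker stays where she is (at the depot initially and in the pushcart systems). - Pcart-N (pushcart, non-interventionist Reopt): reoptimization takes place only when the picker is at the depot (on each return to the depot if new orders have arrived, or on arrival of an order while she is idle at the depot); started batches cannot be modified. - Pcart (pushcart, interventionist Reopt) and Robot (robot, interventionist Reopt): reoptimization takes place at every order arrival; the plan starts from the picker's current position, orders having at least one item already in the current cart must be completed as part of the current batch, and all other bins of the current cart (of $c$ bins, one order per bin) can be freely (re)assigned to not yet commenced orders. Ties between optimal plans are broken by an arbitrary fixed deterministic rule. $Reopt(I)$ is the resulting total completion time (pushcart or robot objective according to the system), and $CIOPT(I)$ is taken for the same cart type. Asymptotic competitive ratio. An algorithm $ALG$ is asymptotically $\alpha$-competitive if for any instance $I$ there is a constant $const$, independent of the number and characteristics of the orders in $I$ but possibly dependent on the warehouse geometry, such that $ALG(I)\le\alpha\cdot CIOPT(I)+const$. $\sigma_{asymp.}(ALG)$ is the infimum of all $\alpha$ such that $ALG$ is asymptotically $\alpha$-competitive. *)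

theory Defs
  imports "HOL-Complex_Analysis.Great_Picard"
begin

section \<open>Warehouse\<close>

type_synonym point = "real \<times> real"

record warehouse =
  width :: real
  len :: real
  aisle_count :: nat
  cross_count :: nat
  depot :: point

text \<open>For a single aisle, the coordinate below is \<open>0 * L / 0 = 0\<close>.\<close>

definition aisles :: "warehouse \<Rightarrow> point set" where
  "aisles G = {(real i * len G / real (aisle_count G - 1), y) | i y.
     i < aisle_count G \<and> 0 \<le> y \<and> y \<le> width G}"

definition cross_aisles :: "warehouse \<Rightarrow> point set" where
  "cross_aisles G = {(x, real k * width G / real (cross_count G - 1)) | x k.
     k < cross_count G \<and> 0 \<le> x \<and> x \<le> len G}"

definition grid :: "warehouse \<Rightarrow> point set" where
  "grid G = aisles G \<union> cross_aisles G"

definition valid_warehouse :: "warehouse \<Rightarrow> bool" where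
  "valid_warehouse G \<longleftrightarrow>
     width G > 0 \<and> aisle_count G \<ge> 1 \<and> cross_count G \<ge> 2 \<and>
     (aisle_count G = 1 \<longrightarrow> len G = 0) \<and> (aisle_count G > 1 \<longrightarrow> len G > 0) \<and>
     depot G \<in> grid G"

text \<open>
  Moving in the grid with speed at most 1 (i.e. at unit speed, with waiting) means following a
  curve in the grid that is 1-Lipschitz for the Euclidean distance. The shortest-path
  distance is the least time such a motion needs.
\<close>

definition moves :: "warehouse \<Rightarrow> real set \<Rightarrow> (real \<Rightarrow> point) \<Rightarrow> bool" where
  "moves G X \<gamma> \<longleftrightarrow> 1-lipschitz_on X \<gamma> \<and> \<gamma> ` X \<subseteq> grid G"

definition gdist :: "warehouse \<Rightarrow> point \<Rightarrow> point \<Rightarrow> real" where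
  "gdist G p q = Inf {T. 0 \<le> T \<and> (\<exists>\<gamma>. moves G {0..T} \<gamma> \<and> \<gamma> 0 = p \<and> \<gamma> T = q)}"


section \<open>Instances and offline solutions\<close>

text \<open>An order is its arrival time together with its set of picking locations; orders are
  referred to by their index in the order sequence, items by order index and location.\<close>

type_synonym order = "real \<times> point set"
type_synonym item = "nat \<times> point"
type_synonym batch = "item list"

definition items :: "order list \<Rightarrow> item set" where
  "items os = {(j, l). j < length os \<and> l \<in> snd (os ! j)}"

definition valid_orders :: "warehouse \<Rightarrow> order list \<Rightarrow> bool" where
  "valid_orders G os \<longleftrightarrow>
     sorted (map fst os) \<and>
     (\<forall>(r, ls) \<in> set os. 0 \<le> r \<and> finite ls \<and> ls \<noteq> {} \<and> ls \<subseteq> aisles G)"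

definition valid_instance :: "warehouse \<Rightarrow> nat \<Rightarrow> order list \<Rightarrow> bool" where
  "valid_instance G c os \<longleftrightarrow> valid_warehouse G \<and> c \<ge> 1 \<and> valid_orders G os"

abbreviation batch_orders :: "batch \<Rightarrow> nat set" where
  "batch_orders b \<equiv> fst ` set b"

abbreviation disjoint_batches :: "batch list \<Rightarrow> bool" where
  "disjoint_batches \<equiv> sorted_wrt (\<lambda>b b'. batch_orders b \<inter> batch_orders b' = {})"

definition solution :: "nat \<Rightarrow> order list \<Rightarrow> batch list \<Rightarrow> bool" where
  "solution c os bs \<longleftrightarrow>
     [] \<notin> set bs \<and> distinct (concat bs) \<and> set (concat bs) = items os \<and>
     disjoint_batches bs \<and> (\<forall>b\<in>set bs. card (batch_orders b) \<le> c)"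

datatype system = Pcart_N | Pcart | Robot

datatype step = Pick nat point | End_batch

definition batch_steps :: "batch \<Rightarrow> step list" where
  "batch_steps b = map (\<lambda>(j, l). Pick j l) b @ [End_batch]"

text \<open>Ending a batch takes a pushcart to the depot; a robot is exchanged on the spot.\<close>

fun dest :: "system \<Rightarrow> warehouse \<Rightarrow> point \<Rightarrow> step \<Rightarrow> point" where
  "dest sys G p (Pick j l) = l"
| "dest sys G p End_batch = (if sys = Robot then p else depot G)"

text \<open>Completion time of a sequence of steps started at time \<open>t\<close> at \<open>p\<close>, where the items of
  order \<open>j\<close> are available from time \<open>r j\<close> on: the picker may walk to an item in advance
  and waits there if it is not yet available.\<close>

fun completion :: "system \<Rightarrow> warehouse \<Rightarrow> (nat \<Rightarrow> real) \<Rightarrow> real \<Rightarrow> point \<Rightarrow> step list \<Rightarrow> real" where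
  "completion sys G r t p [] = t"
| "completion sys G r t p (x # xs) =
     (let q = dest sys G p x;
          t' = t + gdist G p q
      in completion sys G r (case x of Pick j l \<Rightarrow> max t' (r j) | End_batch \<Rightarrow> t') q xs)"

definition CIOPT :: "system \<Rightarrow> warehouse \<Rightarrow> nat \<Rightarrow> order list \<Rightarrow> real" where
  "CIOPT sys G c os =
     Inf {completion sys G (\<lambda>j. fst (os ! j)) 0 (depot G) (concat (map batch_steps bs)) | bs.
            solution c os bs}"


section \<open>The online policy Reopt\<close>

text \<open>\<open>cart\<close>: the orders with at least one item in the current cart, including completely
  picked ones that still occupy a bin; \<open>picked\<close>: all items picked so far.\<close>

record state =
  clock :: real
  pos :: point
  cart :: "nat set"
  picked :: "item set"

text \<open>A plan \<open>(cur, fut)\<close> consists of the remaining visits \<open>cur\<close> of the current batch and of the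
  batches \<open>fut\<close> that follow.\<close>

type_synonym plan = "batch \<times> batch list"

definition plan_steps :: "plan \<Rightarrow> step list" where
  "plan_steps = (\<lambda>(cur, fut). concat (map batch_steps (cur # fut)))"

definition feasible_plan :: "nat \<Rightarrow> order list \<Rightarrow> state \<Rightarrow> plan \<Rightarrow> bool" where
  "feasible_plan c ks S = (\<lambda>(cur, fut).
     [] \<notin> set fut \<and> distinct (concat (cur # fut)) \<and>
     set (concat (cur # fut)) = items ks - picked S \<and>
     disjoint_batches (cur # fut) \<and>
     (\<forall>(j, l) \<in> items ks - picked S. j \<in> cart S \<longrightarrow> (j, l) \<in> set cur) \<and>
     card (cart S \<union> batch_orders cur) \<le> c \<and>
     (\<forall>b\<in>set fut. card (batch_orders b) \<le> c))"

definition plan_cost :: "system \<Rightarrow> warehouse \<Rightarrow> state \<Rightarrow> plan \<Rightarrow> real" where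
  "plan_cost sys G S pl = completion sys G (\<lambda>_. 0) 0 (pos S) (plan_steps pl)"

definition optimal_plan :: "system \<Rightarrow> warehouse \<Rightarrow> nat \<Rightarrow> order list \<Rightarrow> state \<Rightarrow> plan \<Rightarrow> bool" where
  "optimal_plan sys G c ks S pl \<longleftrightarrow> feasible_plan c ks S pl \<and>
     (\<forall>pl'. feasible_plan c ks S pl' \<longrightarrow> plan_cost sys G S pl \<le> plan_cost sys G S pl')"

text \<open>\<open>\<tau>\<close> is at \<open>p\<close> at time \<open>t\<close>, then performs the steps without delay and finally stays put.\<close>

fun visits :: "system \<Rightarrow> warehouse \<Rightarrow> (real \<Rightarrow> point) \<Rightarrow> real \<Rightarrow> point \<Rightarrow> step list \<Rightarrow> bool" where
  "visits sys G \<tau> t p [] \<longleftrightarrow> (\<forall>s\<ge>t. \<tau> s = p)"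
| "visits sys G \<tau> t p (x # xs) \<longleftrightarrow>
     \<tau> t = p \<and> (let q = dest sys G p x in visits sys G \<tau> (t + gdist G p q) q xs)"

text \<open>A reoptimization at a state \<open>S\<close> yields a plan and a motion of the picker (as a function of
  the time elapsed since then) that carries it out. The motion matters only for the interventionist
  systems, where an arrival can find the picker between two stops and there may be several shortest
  paths. A tie-breaking rule sees the known orders \<open>ks\<close> only.\<close>

type_synonym rule = "warehouse \<Rightarrow> nat \<Rightarrow> order list \<Rightarrow> state \<Rightarrow> plan \<times> (real \<Rightarrow> point)"

definition tie_breaking_rule :: "system \<Rightarrow> rule \<Rightarrow> bool" where
  "tie_breaking_rule sys rule \<longleftrightarrow>
     (\<forall>G c ks S. valid_instance G c ks \<and> pos S \<in> grid G \<and> finite (cart S) \<and> card (cart S) \<le> c \<longrightarrow>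
        (case rule G c ks S of (pl, \<tau>) \<Rightarrow>
           optimal_plan sys G c ks S pl \<and>
           moves G {0..} \<tau> \<and> visits sys G \<tau> 0 (pos S) (plan_steps pl)))"

text \<open>Orders that have arrived by time \<open>t\<close>; this is a prefix, as arrival times are sorted.\<close>

definition known :: "real \<Rightarrow> order list \<Rightarrow> order list" where
  "known t os = takeWhile (\<lambda>ord. fst ord \<le> t) os"


subsection \<open>Interventionist systems\<close>

fun perform :: "step \<Rightarrow> state \<Rightarrow> state" where
  "perform (Pick j l) S = S\<lparr>cart := insert j (cart S), picked := insert (j, l) (picked S)\<rparr>"
| "perform End_batch S = S\<lparr>cart := {}\<rparr>"

text \<open>Cart and picked items after following the steps from \<open>p\<close> for \<open>\<Delta>\<close> time units.\<close>

fun follow :: "system \<Rightarrow> warehouse \<Rightarrow> real \<Rightarrow> point \<Rightarrow> step list \<Rightarrow> state \<Rightarrow> state" where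
  "follow sys G \<Delta> p [] S = S"
| "follow sys G \<Delta> p (x # xs) S =
     (let q = dest sys G p x
      in if gdist G p q \<le> \<Delta> then follow sys G (\<Delta> - gdist G p q) q xs (perform x S) else S)"

text \<open>Run from a state \<open>S\<close> at which the picker reoptimizes; \<open>ts\<close> are the later arrival times.\<close>

primrec run :: "system \<Rightarrow> rule \<Rightarrow> warehouse \<Rightarrow> nat \<Rightarrow> order list \<Rightarrow> real list \<Rightarrow> state \<Rightarrow> real" where
  "run sys rule G c os [] S =
     clock S + plan_cost sys G S (fst (rule G c (known (clock S) os) S))"
| "run sys rule G c os (t # ts) S =
     (let (pl, \<tau>) = rule G c (known (clock S) os) S;
          \<Delta> = t - clock S
      in run sys rule G c os ts
           ((follow sys G \<Delta> (pos S) (plan_steps pl) S)\<lparr>clock := t, pos := \<tau> \<Delta>\<rparr>))"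

definition depot_state :: "warehouse \<Rightarrow> real \<Rightarrow> item set \<Rightarrow> state" where
  "depot_state G t P = \<lparr>clock = t, pos = depot G, cart = {}, picked = P\<rparr>"

definition reopt_interv :: "system \<Rightarrow> rule \<Rightarrow> warehouse \<Rightarrow> nat \<Rightarrow> order list \<Rightarrow> real" where
  "reopt_interv sys rule G c os =
     (case remdups (map fst os) of [] \<Rightarrow> 0
      | t # ts \<Rightarrow> run sys rule G c os ts (depot_state G t {}))"


subsection \<open>Non-interventionist system\<close>

text \<open>State at the depot: time, picked items, batches still to do in the current plan, and
  orders known at the last reoptimization.\<close>

type_synonym nstate = "real \<times> item set \<times> batch list \<times> order list"

text \<open>One round: wait at the depot until some arrived order is unserved, reoptimize if orders
  have arrived since the last reoptimization, and carry out the next batch of the plan.\<close>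

definition nround :: "rule \<Rightarrow> warehouse \<Rightarrow> nat \<Rightarrow> order list \<Rightarrow> nstate \<Rightarrow> nstate" where
  "nround rule G c os = (\<lambda>(t, P, bs, ks).
     if items os \<subseteq> P then (t, P, bs, ks)
     else
       let t' = max t (Min {fst (os ! j) | j l. (j, l) \<in> items os - P});
           ks' = known t' os;
           bs' = (if ks' = ks then bs
                  else (case fst (rule G c ks' (depot_state G t' P)) of
                          (cur, fut) \<Rightarrow> filter (\<lambda>b. b \<noteq> []) (cur # fut)));
           b = hd bs'
       in (completion Pcart_N G (\<lambda>_. 0) t' (depot G) (batch_steps b),
           P \<union> set b, tl bs', ks'))"

text \<open>Every round with unserved orders serves at least one of them, so \<open>length os\<close> rounds
  suffice.\<close>

definition reopt_noninterv :: "rule \<Rightarrow> warehouse \<Rightarrow> nat \<Rightarrow> order list \<Rightarrow> real" where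
  "reopt_noninterv rule G c os = fst ((nround rule G c os ^^ length os) (0, {}, [], []))"

definition reopt :: "system \<Rightarrow> rule \<Rightarrow> warehouse \<Rightarrow> nat \<Rightarrow> order list \<Rightarrow> real" where
  "reopt sys rule = (if sys = Pcart_N then reopt_noninterv rule else reopt_interv sys rule)"


section \<open>Asymptotic competitive ratio\<close>

definition asymp_competitive ::
    "system \<Rightarrow> (warehouse \<Rightarrow> nat \<Rightarrow> order list \<Rightarrow> real) \<Rightarrow> real \<Rightarrow> bool" where
  "asymp_competitive sys ALG \<alpha> \<longleftrightarrow>
     (\<forall>G. \<exists>const. \<forall>c os. valid_instance G c os \<longrightarrow> ALG G c os \<le> \<alpha> * CIOPT sys G c os + const)"

definition sigma_asymp :: "system \<Rightarrow> (warehouse \<Rightarrow> nat \<Rightarrow> order list \<Rightarrow> real) \<Rightarrow> ereal" where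
  "sigma_asymp sys ALG = Inf {ereal \<alpha> | \<alpha>. asymp_competitive sys ALG \<alpha>}"


section \<open>The minima exist\<close>

text \<open>Shortest paths, \<^const>\<open>CIOPT\<close> and optimal plans are attained, so tie-breaking rules exist.\<close>

lemma compact_grid: "compact (grid G)"
proof -
  have 1: "aisles G = (\<Union>i<aisle_count G. {real i * len G / real (aisle_count G - 1)} \<times> {0..width G})"
    unfolding aisles_def by auto
  have 2: "cross_aisles G = (\<Union>k<cross_count G. {0..len G} \<times> {real k * width G / real (cross_count G - 1)})"
    unfolding cross_aisles_def by auto
  show ?thesis unfolding grid_def 1 2
    by (intro compact_Un compact_UN compact_Times) auto
qed

definition reach :: "warehouse \<Rightarrow> point \<Rightarrow> point \<Rightarrow> real \<Rightarrow> bool" where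
  "reach G p q T \<longleftrightarrow> 0 \<le> T \<and> (\<exists>\<gamma>. moves G {0..T} \<gamma> \<and> \<gamma> 0 = p \<and> \<gamma> T = q)"

lemma gdist_reach: "gdist G p q = Inf {T. reach G p q T}"
  unfolding gdist_def reach_def ..

lemma moves_glue:
  assumes "moves G {a..b} f" "moves G {b..c} g" "f b = g b"
  shows "moves G {a..c} (\<lambda>x. if x \<le> b then f x else g x)"
  using assms unfolding moves_def
  by (auto intro!: lipschitz_on_concat simp: image_subset_iff)

lemma moves_shift:
  assumes "moves G {a..b} f"
  shows "moves G {a + t..b + t} (\<lambda>x. f (x - t))"
  unfolding moves_def
proof (intro conjI lipschitz_onI)
  fix x y assume "x \<in> {a + t..b + t}" "y \<in> {a + t..b + t}"
  then have "dist (f (x - t)) (f (y - t)) \<le> 1 * dist (x - t) (y - t)"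
    using assms unfolding moves_def by (intro lipschitz_onD[of 1 "{a..b}" f]) auto
  then show "dist (f (x - t)) (f (y - t)) \<le> 1 * dist x y" by (simp add: dist_real_def)
qed (use assms in \<open>auto simp: moves_def\<close>)

lemma reach_trans:
  assumes "reach G p q S" "reach G q r T"
  shows "reach G p r (S + T)"
proof -
  obtain f where f: "0 \<le> S" "moves G {0..S} f" "f 0 = p" "f S = q"
    using assms unfolding reach_def by blast
  obtain g where g: "0 \<le> T" "moves G {0..T} g" "g 0 = q" "g T = r"
    using assms unfolding reach_def by blast
  have "moves G {0..S+T} (\<lambda>x. if x \<le> S then f x else g (x - S))"
    using moves_shift[OF g(2), of S] f g by (intro moves_glue) (auto simp: add.commute)
  then show ?thesis unfolding reach_def
    using f g by (intro conjI exI[of _ "\<lambda>x. if x \<le> S then f x else g (x - S)"]) auto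
qed

lemma reach_sym: 
  assumes "reach G p q T" shows "reach G q p T"
proof -
  obtain g where g: "0 \<le> T" "moves G {0..T} g" "g 0 = p" "g T = q"
    using assms unfolding reach_def by blast
  have "moves G {0..T} (\<lambda>x. g (T - x))"
    unfolding moves_def
  proof (intro conjI lipschitz_onI)
    fix x y assume "x \<in> {0..T}" "y \<in> {0..T}"
    then have "dist (g (T - x)) (g (T - y)) \<le> 1 * dist (T - x) (T - y)"
      using g(2) unfolding moves_def by (intro lipschitz_onD[of 1 "{0..T}" g]) auto
    then show "dist (g (T - x)) (g (T - y)) \<le> 1 * dist x y"
      by (simp add: dist_real_def abs_minus_commute)
  qed (use g(2) in \<open>auto simp: moves_def\<close>)
  then show ?thesis unfolding reach_def using g by (intro conjI exI[of _ "\<lambda>x. g (T - x)"]) auto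
qed

lemma reach_line:
  assumes "closed_segment p q \<subseteq> grid G"
  shows "reach G p q (dist p q)"
proof (cases "p = q")
  case True
  then show ?thesis using assms unfolding reach_def moves_def
    by (intro conjI exI[of _ "\<lambda>_. p"]) (auto simp: lipschitz_on_def)
next
  case False
  define T where "T = dist p q"
  have T: "T > 0" using False T_def by simp
  let ?g = "\<lambda>t. p + (t / T) *\<^sub>R (q - p)"
  have "dist (?g s) (?g t) = dist s t" for s t
  proof -
    have "?g s - ?g t = ((s - t) / T) *\<^sub>R (q - p)" by (simp add: algebra_simps diff_divide_distrib)
    then have "dist (?g s) (?g t) = \<bar>s - t\<bar> / T * norm (q - p)"
      using T by (simp add: dist_norm)
    also have "norm (q - p) = T" by (simp add: T_def dist_norm norm_minus_commute)
    finally show ?thesis using T by (simp add: dist_real_def)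
  qed
  then have "1-lipschitz_on {0..T} ?g" by (auto simp: lipschitz_on_def)
  moreover have "?g ` {0..T} \<subseteq> grid G"
  proof -
    have "?g t \<in> closed_segment p q" if "0 \<le> t" "t \<le> T" for t
      unfolding in_segment using that T
      by (intro exI[of _ "t / T"]) (auto simp: algebra_simps)
    then show ?thesis using assms by auto
  qed
  ultimately show ?thesis unfolding reach_def T_def[symmetric] moves_def
    using T by (intro conjI exI[of _ ?g]) auto
qed

lemma reach_origin:
  assumes G: "valid_warehouse G" and p: "p \<in> grid G"
  shows "\<exists>T. reach G p (0, 0) T"
proof -
  have L: "len G \<ge> 0" "width G > 0" "aisle_count G \<ge> 1" "cross_count G \<ge> 2"
    using G unfolding valid_warehouse_def by (metis le_less linorder_not_less nat_less_le order.refl, auto)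
  have bottom: "(x, 0) \<in> grid G" if "0 \<le> x" "x \<le> len G" for x
    unfolding grid_def cross_aisles_def using that L by (auto intro!: exI[of _ "0::nat"])
  have left: "(0, y) \<in> grid G" if "0 \<le> y" "y \<le> width G" for y
    unfolding grid_def aisles_def using that L by (auto intro!: exI[of _ "0::nat"])
  have sub: "(1 - u) * a \<le> m" if "0 \<le> a" "a \<le> m" "0 \<le> u" "u \<le> 1" for a u m :: real
    using mult_right_mono[of "1 - u" 1 a] that by simp
  have frac: "0 \<le> real i * m / real n \<and> real i * m / real n \<le> m" if "0 \<le> m" "i \<le> n" for i n m
    using that mult_right_mono[of "real i" "real n" m]
    by (cases "n = 0") (auto simp: divide_le_eq mult.commute)
  have hor: "\<exists>T. reach G (x, y) (0, y) T"
    if H: "\<And>x'. 0 \<le> x' \<Longrightarrow> x' \<le> len G \<Longrightarrow> (x', y) \<in> grid G" "0 \<le> x" "x \<le> len G" for x y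
  proof (rule exI, rule reach_line, rule subsetI)
    fix z assume "z \<in> closed_segment (x, y) (0, y)"
    then obtain u where u: "0 \<le> u" "u \<le> 1" "z = (1 - u) *\<^sub>R (x, y) + u *\<^sub>R (0, y)"
      unfolding in_segment by blast
    have z: "z = ((1 - u) * x, y)" using u(3) by (simp add: scaleR_prod_def algebra_simps)
    show "z \<in> grid G" unfolding z using sub[OF H(2,3) u(1,2)] u(1,2) H(2) by (intro H(1)) auto
  qed
  have ver: "\<exists>T. reach G (x, y) (x, 0) T"
    if H: "\<And>y'. 0 \<le> y' \<Longrightarrow> y' \<le> width G \<Longrightarrow> (x, y') \<in> grid G" "0 \<le> y" "y \<le> width G" for x y
  proof (rule exI, rule reach_line, rule subsetI)
    fix z assume "z \<in> closed_segment (x, y) (x, 0)"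
    then obtain u where u: "0 \<le> u" "u \<le> 1" "z = (1 - u) *\<^sub>R (x, y) + u *\<^sub>R (x, 0)"
      unfolding in_segment by blast
    have z: "z = (x, (1 - u) * y)" using u(3) by (simp add: scaleR_prod_def algebra_simps)
    show "z \<in> grid G" unfolding z using sub[OF H(2,3) u(1,2)] u(1,2) H(2) by (intro H(1)) auto
  qed
  from p consider (A) "p \<in> aisles G" | (C) "p \<in> cross_aisles G" unfolding grid_def by blast
  then show ?thesis
  proof cases
    case A
    then obtain i y where i: "p = (real i * len G / real (aisle_count G - 1), y)"
       "i < aisle_count G" "0 \<le> y" "y \<le> width G" unfolding aisles_def by blast
    let ?x = "real i * len G / real (aisle_count G - 1)"
    have x: "0 \<le> ?x" "?x \<le> len G" 
      using frac[of "len G" i "aisle_count G - 1"] i(2) L by auto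
    have "(?x, y') \<in> grid G" if "0 \<le> y'" "y' \<le> width G" for y'
      using that i(2) unfolding grid_def aisles_def by blast
    then show ?thesis unfolding i(1)
      using ver[of ?x y] hor[of 0 ?x] bottom x i(3,4) reach_trans by blast
  next
    case C
    then obtain k x where k: "p = (x, real k * width G / real (cross_count G - 1))"
       "k < cross_count G" "0 \<le> x" "x \<le> len G" unfolding cross_aisles_def by blast
    let ?y = "real k * width G / real (cross_count G - 1)"
    have y: "0 \<le> ?y" "?y \<le> width G"
      using frac[of "width G" k "cross_count G - 1"] k(2) L by auto
    have "(x', ?y) \<in> grid G" if "0 \<le> x'" "x' \<le> len G" for x'
      using that k(2) unfolding grid_def cross_aisles_def by blast
    then show ?thesis unfolding k(1)
      using hor[of ?y x] ver[of 0 ?y] left y k(3,4) reach_trans by blast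
  qed
qed

lemma reach_attained:
  assumes G: "valid_warehouse G" and p: "p \<in> grid G" and q: "q \<in> grid G"
  shows "reach G p q (gdist G p q)"
proof -
  define D where "D = gdist G p q"
  have ne: "{T. reach G p q T} \<noteq> {}"
    using reach_origin[OF G p] reach_origin[OF G q] reach_trans reach_sym by blast
  have bdd: "bdd_below {T. reach G p q T}"
    by (rule bdd_belowI[of _ 0]) (auto simp: reach_def)
  have Dle: "D \<le> T" if "reach G p q T" for T
    unfolding D_def gdist_reach using that bdd by (intro cInf_lower) auto
  have D0: "0 \<le> D" unfolding D_def gdist_reach using ne by (intro cInf_greatest) (auto simp: reach_def)
  have "\<exists>T. reach G p q T \<and> T < D + 1 / real (Suc n)" for n
    using cInf_lessD[OF ne, of "D + 1 / real (Suc n)"] unfolding D_def gdist_reach by auto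
  then obtain T where T: "\<And>n. reach G p q (T n)" "\<And>n. T n < D + 1 / real (Suc n)"
    by metis
  then obtain g where g: "\<And>n. moves G {0..T n} (g n)" "\<And>n. g n 0 = p" "\<And>n. g n (T n) = q" 
    unfolding reach_def by metis
  have DT: "D \<le> T n" for n using Dle T by blast
  have lip: "norm (g n x - g n y) \<le> norm (x - y)" if "x \<in> {0..D}" "y \<in> {0..D}" for n x y
  proof -
    have "x \<in> {0..T n}" "y \<in> {0..T n}" using that DT[of n] by auto
    then show ?thesis using g(1)[of n] lipschitz_on_normD[of 1] unfolding moves_def by fastforce
  qed
  have ing: "g n x \<in> grid G" if "x \<in> {0..D}" for n x
  proof -
    have "x \<in> {0..T n}" using that DT[of n] by auto
    then show ?thesis using g(1)[of n] unfolding moves_def by blast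
  qed
  obtain M where M: "\<And>z. z \<in> grid G \<Longrightarrow> norm z \<le> M"
    using compact_imp_bounded[OF compact_grid[of G]] unfolding bounded_iff by blast
  obtain h k where h: "continuous_on {0..D} h" "strict_mono (k :: nat \<Rightarrow> nat)"
      "\<And>e. 0 < e \<Longrightarrow> \<exists>N. \<forall>n x. n \<ge> N \<and> x \<in> {0..D} \<longrightarrow> norm (g (k n) x - h x) < e"
  proof (rule Arzela_Ascoli[of "{0..D}" g M])
    show "\<exists>d>0. \<forall>n y. y \<in> {0..D} \<and> norm (x - y) < d \<longrightarrow> norm (g n x - g n y) < e"
      if "x \<in> {0..D}" "0 < e" for x e
      using that lip by (intro exI[of _ e]) (auto intro: le_less_trans)
  qed (use ing M in auto)
  have lim: "(\<lambda>n. g (k n) x) \<longlonglongrightarrow> h x" if "x \<in> {0..D}" for x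
    unfolding LIMSEQ_iff using h(3) that by blast
  have "norm (h x - h y) \<le> norm (x - y)" if "x \<in> {0..D}" "y \<in> {0..D}" for x y
    by (rule LIMSEQ_le_const2[OF tendsto_norm[OF tendsto_diff[OF lim[OF that(1)] lim[OF that(2)]]]])
       (use lip that in auto)
  then have 1: "1-lipschitz_on {0..D} h" by (auto simp: lipschitz_on_def dist_norm)
  have 2: "h x \<in> grid G" if "x \<in> {0..D}" for x
    by (rule closed_sequentially[OF compact_imp_closed[OF compact_grid] _ lim[OF that]])
       (use ing that in auto)
  have 3: "h 0 = p" using LIMSEQ_unique[OF lim[of 0], of p] g(2) D0 by simp
  have "norm (g n D - q) \<le> 1 / real (Suc n)" for n
  proof -
    have "norm (g n D - g n (T n)) \<le> norm (D - T n)"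
      using g(1)[of n] lipschitz_on_normD[of 1 "{0..T n}" "g n" D "T n"] DT[of n] D0
      unfolding moves_def by fastforce
    also have "\<dots> \<le> 1 / real (Suc n)" using T(2)[of n] DT[of n] by simp
    finally show ?thesis by (simp add: g)
  qed
  then have "(\<lambda>n. g n D - q) \<longlonglongrightarrow> 0"
    by (intro Lim_null_comparison[OF _ LIMSEQ_Suc[OF lim_1_over_n]]) (auto simp: always_eventually)
  then have "(\<lambda>n. g n D) \<longlonglongrightarrow> q" by (simp add: LIM_zero_iff)
  then have "(\<lambda>n. g (k n) D) \<longlonglongrightarrow> q" using h(2) LIMSEQ_subseq_LIMSEQ[of "\<lambda>n. g n D" q k] by (simp add: o_def)
  then have 4: "h D = q" using LIMSEQ_unique[OF lim[of D]] D0 by simp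
  have "moves G {0..D} h" unfolding moves_def using 1 2 by (simp add: image_subset_iff)
  then show ?thesis unfolding reach_def D_def[symmetric]
    by (intro conjI D0 exI[of _ h] 3 4)
qed

lemma visits_cong:
  assumes "\<And>s. s \<ge> t \<Longrightarrow> \<tau> s = \<tau>' s" "visits sys G \<tau> t p xs"
    "valid_warehouse G" "p \<in> grid G" "\<And>j l. Pick j l \<in> set xs \<Longrightarrow> l \<in> grid G"
  shows "visits sys G \<tau>' t p xs"
  using assms
proof (induction xs arbitrary: t p)
  case Nil then show ?case by simp
next
  case (Cons x xs)
  have q: "dest sys G p x \<in> grid G" using Cons.prems
    by (cases x) (auto simp: valid_warehouse_def)
  have "0 \<le> gdist G p (dest sys G p x)" 
    using reach_attained[OF Cons.prems(3,4) q] by (simp add: reach_def)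
  then have "visits sys G \<tau>' (t + gdist G p (dest sys G p x)) (dest sys G p x) xs"
    using Cons.prems q by (intro Cons.IH) (auto simp: Let_def)
  then show ?case using Cons.prems(1,2) by (auto simp: Let_def)
qed

lemma visits_start: "visits sys G \<tau> t p xs \<Longrightarrow> \<tau> t = p"
  by (cases xs) auto

lemma motion_exists:
  assumes "valid_warehouse G" "p \<in> grid G" "\<And>j l. Pick j l \<in> set xs \<Longrightarrow> l \<in> grid G"
  shows "\<exists>\<tau>. moves G {t..} \<tau> \<and> visits sys G \<tau> t p xs"
  using assms
proof (induction xs arbitrary: t p)
  case Nil
  then show ?case 
    by (intro exI[of _ "\<lambda>_. p"]) (auto simp: moves_def lipschitz_on_def)
next
  case (Cons x xs)
  define q where "q = dest sys G p x"
  define D where "D = gdist G p q"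
  have q: "q \<in> grid G" using Cons.prems unfolding q_def
    by (cases x) (auto simp: valid_warehouse_def)
  from reach_attained[OF Cons.prems(1,2) q] obtain \<gamma> where
    g: "0 \<le> D" "moves G {0..D} \<gamma>" "\<gamma> 0 = p" "\<gamma> D = q" unfolding reach_def D_def by blast
  obtain \<tau> where \<tau>: "moves G {t + D..} \<tau>" "visits sys G \<tau> (t + D) q xs"
    using Cons.IH[OF Cons.prems(1) q, of "t + D"] Cons.prems(3) by auto
  let ?s = "\<lambda>x. if x \<le> t + D then \<gamma> (x - t) else \<tau> x"
  have \<tau>0: "\<tau> (t + D) = q" using visits_start[OF \<tau>(2)] .
  have c: "moves G {t..c} ?s" for c
    using moves_shift[OF g(2), of t] \<tau>(1) \<tau>0 g(4)
    by (intro moves_glue) (auto simp: add.commute moves_def intro: lipschitz_on_mono)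
  have "moves G {t..} ?s" unfolding moves_def
  proof (intro conjI lipschitz_onI)
    fix x y assume "x \<in> {t..}" "y \<in> {t..}"
    then show "dist (?s x) (?s y) \<le> 1 * dist x y"
      using c[of "max x y"] unfolding moves_def 
      by (intro lipschitz_onD[of 1 "{t..max x y}" ?s]) auto
  next
    show "?s ` {t..} \<subseteq> grid G"
    proof
      fix z assume "z \<in> ?s ` {t..}"
      then obtain x where x: "z = ?s x" "t \<le> x" by blast
      then have "x \<in> {t..x}" by simp
      then show "z \<in> grid G" using c[of x] unfolding moves_def x(1) by blast
    qed
  qed simp
  moreover have "visits sys G ?s (t + D) q xs"
  proof (rule visits_cong[OF _ \<tau>(2) Cons.prems(1) q])
    show "\<tau> s = ?s s" if "t + D \<le> s" for s using that \<tau>0 g(4) by (cases "s = t + D") auto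
    show "l \<in> grid G" if "Pick j l \<in> set xs" for j l
      using Cons.prems(3)[of j l] that by simp
  qed
  moreover have "?s t = p" using g by simp
  ultimately have "moves G {t..} ?s \<and> visits sys G ?s t p (x # xs)"
    by (simp add: Let_def q_def[symmetric] D_def[symmetric])
  then show ?case by blast
qed

lemma sorted_wrt_map_singletons:
  assumes "distinct js" "\<And>j b. j \<in> set js \<Longrightarrow> batch_orders (f j) \<subseteq> {j}"
  shows "disjoint_batches (map f js)"
  using assms
proof (induction js)
  case (Cons j js)
  have "batch_orders (f j) \<inter> batch_orders (f i) = {}" if "i \<in> set js" for i
  proof -
    have "i \<noteq> j" using that Cons.prems(1) by auto
    moreover have "batch_orders (f j) \<subseteq> {j}" "batch_orders (f i) \<subseteq> {i}"
      using Cons.prems(2) that by auto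
    ultimately show ?thesis by blast
  qed
  then show ?case using Cons by simp
qed simp

lemma finite_items:
  assumes "valid_orders G ks" shows "finite (items ks)"
proof -
  have "items ks = (\<Union>j<length ks. {j} \<times> snd (ks ! j))" unfolding items_def by auto
  moreover have "finite (snd (ks ! j))" if "j < length ks" for j
    using assms nth_mem[OF that] unfolding valid_orders_def by (auto simp: split_beta)
  ultimately show ?thesis by auto
qed

lemma feasible_plan_exists:
  assumes "valid_instance G c ks" "finite (cart S)" "card (cart S) \<le> c"
  shows "\<exists>pl. feasible_plan c ks S pl"
proof -
  define R where "R = items ks - picked S"
  have fin: "finite R" using finite_items assms unfolding R_def valid_instance_def by blast
  obtain cur where cur: "set cur = {x \<in> R. fst x \<in> cart S}" "distinct cur"
    using finite_distinct_list[of "{x \<in> R. fst x \<in> cart S}"] fin by auto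
  have "\<forall>j. \<exists>b. set b = {x \<in> R. fst x = j} \<and> distinct b"
    using fin by (auto intro: finite_distinct_list)
  then obtain f where f: "\<And>j. set (f j) = {x \<in> R. fst x = j}" "\<And>j. distinct (f j)" by metis
  obtain js where js: "set js = fst ` R - cart S" "distinct js"
    using finite_distinct_list[of "fst ` R - cart S"] fin by auto
  let ?fut = "map f js"
  have s: "set (concat ?fut) = {x \<in> R. fst x \<notin> cart S}" using f js by auto
  have dc: "distinct (concat (map f xs))" if "distinct xs" for xs
    using that by (induction xs) (auto simp: f)
  have "[] \<notin> set ?fut"
  proof
    assume "[] \<in> set ?fut"
    then obtain j where "j \<in> set js" "f j = []" by auto
    then show False using f(1)[of j] js(1) by fastforce
  qed
  moreover have "disjoint_batches (cur # ?fut)"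
    using sorted_wrt_map_singletons[OF js(2), of f] f(1) cur js(1) by (auto simp: f)
  moreover have "cart S \<union> batch_orders cur = cart S" using cur by auto
  moreover have "card (batch_orders (f j)) \<le> c" for j
  proof -
    have "card (batch_orders (f j)) \<le> card {j}" by (rule card_mono) (auto simp: f)
    then show ?thesis using assms(1) unfolding valid_instance_def by simp
  qed
  moreover have "distinct (concat (cur # ?fut))" using dc[OF js(2)] cur s by auto
  moreover have "set (concat (cur # ?fut)) = R" using s cur(1) by auto
  ultimately have "feasible_plan c ks S (cur, ?fut)"
    unfolding feasible_plan_def R_def[symmetric] using assms(3) cur(1) by auto
  then show ?thesis ..
qed

lemma finite_nonempty_partitions:
  assumes "finite R"
  shows "finite {bs :: 'a list list. [] \<notin> set bs \<and> distinct (concat bs) \<and> set (concat bs) \<subseteq> R}"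
proof -
  let ?B = "{xs. set xs \<subseteq> R \<and> length xs \<le> card R}"
  have len: "length bs \<le> length (concat bs)" if "[] \<notin> set bs" for bs :: "'a list list"
    using that
  proof (induction bs)
    case (Cons b bs)
    then have "length b \<ge> 1" by (cases b) auto
    then show ?case using Cons by auto
  qed simp
  have "{bs :: 'a list list. [] \<notin> set bs \<and> distinct (concat bs) \<and> set (concat bs) \<subseteq> R}
     \<subseteq> {bs. set bs \<subseteq> ?B \<and> length bs \<le> card R}" (is "?X \<subseteq> _")
  proof
    fix bs assume "bs \<in> ?X"
    then have bs: "[] \<notin> set bs" "distinct (concat bs)" "set (concat bs) \<subseteq> R" by auto
    have le: "length (concat bs) \<le> card R"
      using distinct_card[OF bs(2)] card_mono[OF assms bs(3)] by simp
    have "b \<in> ?B" if "b \<in> set bs" for b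
    proof -
      have "set b \<subseteq> R" using that bs(3) by auto
      moreover have "distinct b" using bs(2) that by (simp add: distinct_concat_iff)
      ultimately show ?thesis using distinct_card[of b] card_mono[OF assms, of "set b"] by auto
    qed
    then show "bs \<in> {bs. set bs \<subseteq> ?B \<and> length bs \<le> card R}" using le len[OF bs(1)] by auto
  qed
  then show ?thesis
    by (rule finite_subset) (intro finite_lists_length_le assms)
qed

lemma finite_feasible_plans:
  assumes "finite (items ks)"
  shows "finite {pl. feasible_plan c ks S pl}"
proof -
  let ?R = "items ks"
  have "{pl. feasible_plan c ks S pl} \<subseteq> {cur. set cur \<subseteq> ?R \<and> distinct cur} \<times>
     {bs. [] \<notin> set bs \<and> distinct (concat bs) \<and> set (concat bs) \<subseteq> ?R}"
    unfolding feasible_plan_def by (auto 0 4)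
  then show ?thesis
    by (rule finite_subset) (intro finite_cartesian_product finite_nonempty_partitions 
      finite_subset_distinct assms)
qed

lemma tie_breaking_rule_exists: "\<exists>rule. tie_breaking_rule sys rule"
proof -
  have "\<exists>out. case out of (pl, \<tau>) \<Rightarrow>
           optimal_plan sys G c ks S pl \<and>
           moves G {0..} \<tau> \<and> visits sys G \<tau> 0 (pos S) (plan_steps pl)"
    if H: "valid_instance G c ks" "pos S \<in> grid G" "finite (cart S)" "card (cart S) \<le> c" for G c ks S
  proof -
    have vo: "valid_orders G ks" "valid_warehouse G" using H(1) unfolding valid_instance_def by auto
    let ?X = "{pl. feasible_plan c ks S pl}"
    have "finite ?X" "?X \<noteq> {}"
      using finite_feasible_plans[OF finite_items[OF vo(1)]] feasible_plan_exists[OF H(1,3,4)] by auto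
    then obtain pl where pl: "pl \<in> ?X" "\<And>x. x \<in> ?X \<Longrightarrow> plan_cost sys G S pl \<le> plan_cost sys G S x"
      using arg_min_if_finite[of ?X "plan_cost sys G S"] by (metis not_le)
    then have opt: "optimal_plan sys G c ks S pl" unfolding optimal_plan_def by auto
    have "l \<in> grid G" if "Pick j l \<in> set (plan_steps pl)" for j l
    proof -
      obtain cur fut where cf: "pl = (cur, fut)" by (cases pl)
      have "(j, l) \<in> set (concat (cur # fut))"
        using that unfolding cf plan_steps_def batch_steps_def by (auto split: if_splits)
      then have "(j, l) \<in> items ks" using pl(1) unfolding cf feasible_plan_def by auto
      then have "j < length ks" "l \<in> snd (ks ! j)" unfolding items_def by auto
      then have "l \<in> aisles G" using vo(1) nth_mem[of j ks] unfolding valid_orders_def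
        by (auto simp: split_beta)
      then show ?thesis unfolding grid_def by blast
    qed
    then have "\<exists>\<tau>. moves G {0..} \<tau> \<and> visits sys G \<tau> 0 (pos S) (plan_steps pl)"
      using vo(2) H(2) by (intro motion_exists)
    then obtain \<tau> where "moves G {0..} \<tau>" "visits sys G \<tau> 0 (pos S) (plan_steps pl)" by blast
    then show ?thesis using opt by (intro exI[of _ "(pl, \<tau>)"]) simp
  qed
  then have "\<exists>rule :: rule. \<forall>G c ks S. valid_instance G c ks \<and> pos S \<in> grid G \<and> finite (cart S) \<and> card (cart S) \<le> c \<longrightarrow>
        (case rule G c ks S of (pl, \<tau>) \<Rightarrow>
           optimal_plan sys G c ks S pl \<and>
           moves G {0..} \<tau> \<and> visits sys G \<tau> 0 (pos S) (plan_steps pl))"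
    by (intro exI[of _ "\<lambda>G c ks S. SOME out. case out of (pl, \<tau>) \<Rightarrow>
           optimal_plan sys G c ks S pl \<and>
           moves G {0..} \<tau> \<and> visits sys G \<tau> 0 (pos S) (plan_steps pl)"] allI impI)
       (rule someI_ex, blast)
  then show ?thesis unfolding tie_breaking_rule_def .
qed

lemma CIOPT_attained:
  assumes "valid_instance G c os"
  shows "\<exists>bs. solution c os bs \<and> CIOPT sys G c os =
     completion sys G (\<lambda>j. fst (os ! j)) 0 (depot G) (concat (map batch_steps bs))"
proof -
  let ?f = "\<lambda>bs. completion sys G (\<lambda>j. fst (os ! j)) 0 (depot G) (concat (map batch_steps bs))"
  have fin: "finite (items os)" using assms finite_items unfolding valid_instance_def by blast
  have "finite {bs. solution c os bs}"
    by (rule finite_subset[OF _ finite_nonempty_partitions[OF fin]]) (auto simp: solution_def)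
  moreover have "\<exists>bs. solution c os bs"
  proof -
    obtain cur fut where F: "feasible_plan c os (depot_state G 0 {}) (cur, fut)"
      using feasible_plan_exists[OF assms, of "depot_state G 0 {}"] by (auto simp: depot_state_def)
    have "solution c os (filter (\<lambda>b. b \<noteq> []) (cur # fut))"
    proof -
      have "filter (\<lambda>b. b \<noteq> []) fut = fut"
        using F unfolding feasible_plan_def by (auto intro: filter_True)
      then show ?thesis using F unfolding feasible_plan_def solution_def depot_state_def by auto
    qed
    then show ?thesis by blast
  qed
  ultimately have "finite (?f ` {bs. solution c os bs})" "?f ` {bs. solution c os bs} \<noteq> {}" by auto
  from Min_in[OF this] cInf_eq_Min[OF this]
  have "Inf (?f ` {bs. solution c os bs}) \<in> ?f ` {bs. solution c os bs}" by simp
  moreover have "CIOPT sys G c os = Inf (?f ` {bs. solution c os bs})"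
    unfolding CIOPT_def by (rule arg_cong[of _ _ Inf]) auto
  ultimately show ?thesis by auto
qed

end

theory Submission
  imports Defs "HOL-Library.Sublist"
begin

text \<open>
  Let \<open>C\<close> be the optimal offline value and \<open>u\<close> the additive constant. Consider the first
  reoptimization at which all orders are known. Everything that Reopt does from then on takes at
  most \<open>C\<close>, up to one pass through the warehouse, and the pass and the time before it
  cost at most \<open>C + u\<close> together; this gives \<open>2 * C + u\<close>.

  \<^item> The constant is the length of a pass through the whole warehouse: from any point of the grid
    to any other there is a walk of length at most \<open>u\<close> through all aisles
    (\<open>walk_through_all_aisles\<close>). It enters at a corner, snakes through the aisles and leaves at
    another corner. Reflecting the snake in the two axes of the warehouse yields four candidates,
    whose lengths are on average at most \<open>u\<close>.

  \<^item> The offline optimum bounds every arrival time, as an item of the last order is picked after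
    its arrival (\<open>CIOPT_ge_arrival\<close>). It also bounds the time to serve any subset of the items
    from the depot when nothing has to be waited for: dropping steps and waiting times never delays
    the picker, by the triangle inequality (\<open>completion_mono\<close>).

  \<^item> In the interventionist systems the last reoptimization is at the last arrival, so at a time of
    at most \<open>C\<close>. From then on, it is possible to complete the current cart and go to the depot by a
    pass through the warehouse, and then to follow the offline solution restricted to the
    remaining orders (\<open>optimal_plan_cost_le_tour\<close>).

  \<^item> In the non-interventionist system the picker may be under way when the last order arrives. Each
    batch of an optimal plan is a shortest round trip for its items, hence of length at most \<open>u\<close>
    (\<open>optimal_plan_round_trip_le\<close>). So she is back at the depot by time \<open>C + u\<close>, and the plan made
    there consists of entire batches and takes at most \<open>C\<close>.
\<close>

section \<open>The grid metric\<close>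

lemma gdist_le_reach: "reach G p q T \<Longrightarrow> gdist G p q \<le> T"
  unfolding gdist_reach by (intro cInf_lower bdd_belowI[of _ 0]) (auto simp: reach_def)

lemma gdist_nonneg: "valid_warehouse G \<Longrightarrow> p \<in> grid G \<Longrightarrow> q \<in> grid G \<Longrightarrow> 0 \<le> gdist G p q"
  using reach_attained unfolding reach_def by blast

lemma gdist_commute: "gdist G p q = gdist G q p"
  unfolding gdist_reach by (rule arg_cong[of _ _ Inf]) (auto intro: reach_sym)

lemma gdist_triangle:
  assumes "valid_warehouse G" "p \<in> grid G" "q \<in> grid G" "m \<in> grid G"
  shows "gdist G p q \<le> gdist G p m + gdist G m q"
  using assms by (intro gdist_le_reach reach_trans) (auto intro: reach_attained)

lemma gdist_le_dist: "closed_segment p q \<subseteq> grid G \<Longrightarrow> gdist G p q \<le> dist p q"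
  by (rule gdist_le_reach[OF reach_line])

lemma gdist_refl: "valid_warehouse G \<Longrightarrow> p \<in> grid G \<Longrightarrow> gdist G p p = 0"
  using gdist_le_dist[of p p G] gdist_nonneg[of G p p] by simp

lemma valid_warehouse_bounds:
  assumes "valid_warehouse G"
  shows "0 < width G" "0 \<le> len G" "1 \<le> aisle_count G" "2 \<le> cross_count G" "depot G \<in> grid G"
proof -
  show "0 \<le> len G"
    using assms unfolding valid_warehouse_def by (cases "aisle_count G = 1") auto
qed (use assms in \<open>auto simp: valid_warehouse_def\<close>)

definition aisle_pos :: "warehouse \<Rightarrow> nat \<Rightarrow> real" where
  "aisle_pos G i = real i * len G / real (aisle_count G - 1)"

definition cross_pos :: "warehouse \<Rightarrow> nat \<Rightarrow> real" where
  "cross_pos G k = real k * width G / real (cross_count G - 1)"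

lemma aisles_iff:
  "p \<in> aisles G \<longleftrightarrow> (\<exists>i<aisle_count G. fst p = aisle_pos G i) \<and> 0 \<le> snd p \<and> snd p \<le> width G"
  unfolding aisles_def aisle_pos_def by (cases p) auto

lemma cross_aisles_iff:
  "p \<in> cross_aisles G \<longleftrightarrow> (\<exists>k<cross_count G. snd p = cross_pos G k) \<and> 0 \<le> fst p \<and> fst p \<le> len G"
  unfolding cross_aisles_def cross_pos_def by (cases p) auto

lemma aisle_in_grid:
  "i < aisle_count G \<Longrightarrow> 0 \<le> y \<Longrightarrow> y \<le> width G \<Longrightarrow> (aisle_pos G i, y) \<in> grid G"
  by (auto simp: grid_def aisles_iff)

lemma cross_in_grid:
  "k < cross_count G \<Longrightarrow> 0 \<le> x \<Longrightarrow> x \<le> len G \<Longrightarrow> (x, cross_pos G k) \<in> grid G"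
  by (auto simp: grid_def cross_aisles_iff)

lemma border_aisles:
  assumes "valid_warehouse G"
  shows "aisle_pos G 0 = 0" "aisle_pos G (aisle_count G - 1) = len G"
  using assms unfolding aisle_pos_def valid_warehouse_def by auto

lemma border_cross_aisles:
  assumes "valid_warehouse G"
  shows "cross_pos G 0 = 0" "cross_pos G (cross_count G - 1) = width G"
  using assms unfolding cross_pos_def valid_warehouse_def by auto

lemma fraction_bounds:
  assumes "0 \<le> m" "i \<le> n"
  shows "0 \<le> real i * m / real n" "real i * m / real n \<le> m"
  using assms mult_right_mono[of "real i" "real n" m]
  by (cases "n = 0"; auto simp: divide_le_eq mult.commute)+

lemma grid_bounds:
  assumes G: "valid_warehouse G" and p: "p \<in> grid G"
  shows "0 \<le> fst p" "fst p \<le> len G" "0 \<le> snd p" "snd p \<le> width G"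
proof -
  note b = valid_warehouse_bounds[OF G]
  have "0 \<le> aisle_pos G i \<and> aisle_pos G i \<le> len G" if "i < aisle_count G" for i
    unfolding aisle_pos_def using fraction_bounds[of "len G" i "aisle_count G - 1"] b that by auto
  moreover have "0 \<le> cross_pos G k \<and> cross_pos G k \<le> width G" if "k < cross_count G" for k
    unfolding cross_pos_def using fraction_bounds[of "width G" k "cross_count G - 1"] b that by auto
  ultimately show "0 \<le> fst p" "fst p \<le> len G" "0 \<le> snd p" "snd p \<le> width G"
    using p unfolding grid_def aisles_iff cross_aisles_iff Un_iff by metis+
qed

lemma gdist_along_aisle:
  assumes "i < aisle_count G" "y \<in> {0..width G}" "y' \<in> {0..width G}"
  shows "gdist G (aisle_pos G i, y) (aisle_pos G i, y') \<le> \<bar>y - y'\<bar>"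
proof -
  have "closed_segment (aisle_pos G i, y) (aisle_pos G i, y') \<subseteq> {aisle_pos G i} \<times> {0..width G}"
    using assms by (intro closed_segment_subset convex_Times) auto
  also have "\<dots> \<subseteq> grid G" using assms by (auto intro: aisle_in_grid)
  finally show ?thesis using gdist_le_dist by (fastforce simp: dist_Pair_Pair dist_real_def)
qed

lemma gdist_along_cross_aisle:
  assumes "k < cross_count G" "x \<in> {0..len G}" "x' \<in> {0..len G}"
  shows "gdist G (x, cross_pos G k) (x', cross_pos G k) \<le> \<bar>x - x'\<bar>"
proof -
  have "closed_segment (x, cross_pos G k) (x', cross_pos G k) \<subseteq> {0..len G} \<times> {cross_pos G k}"
    using assms by (intro closed_segment_subset convex_Times) auto
  also have "\<dots> \<subseteq> grid G" using assms by (auto intro: cross_in_grid)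
  finally show ?thesis using gdist_le_dist by (fastforce simp: dist_Pair_Pair dist_real_def)
qed

text \<open>
  From any grid point a corner is as near as in the Manhattan metric: a point of an aisle
  reaches the border cross-aisle along that aisle, a point of a cross-aisle the border aisle along
  that cross-aisle, and the border leads on to the corner.
\<close>

lemma gdist_corner:
  assumes G: "valid_warehouse G" and p: "p \<in> grid G"
    and X: "X = 0 \<or> X = len G" and Y: "Y = 0 \<or> Y = width G"
  shows "gdist G p (X, Y) \<le> \<bar>fst p - X\<bar> + \<bar>snd p - Y\<bar>"
proof -
  note b = valid_warehouse_bounds[OF G]
  note gb = grid_bounds[OF G p]
  obtain i where i: "i < aisle_count G" "X = aisle_pos G i"
    using X border_aisles[OF G] b by (metis diff_less less_le_trans zero_less_one)
  obtain k where k: "k < cross_count G" "Y = cross_pos G k"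
    using Y border_cross_aisles[OF G] b
    by (metis diff_less less_le_trans zero_less_one zero_less_numeral)
  have XY: "X \<in> {0..len G}" "Y \<in> {0..width G}" using X Y b by auto
  have C: "(X, Y) \<in> grid G" using aisle_in_grid[OF i(1)] i(2) XY by auto
  show ?thesis
  proof (cases "p \<in> aisles G")
    case True
    then obtain i' where i': "i' < aisle_count G" "p = (aisle_pos G i', snd p)"
      unfolding aisles_iff by (cases p) auto
    have m: "(fst p, Y) \<in> grid G" using cross_in_grid[OF k(1)] k(2) gb by auto
    have "gdist G p (X, Y) \<le> gdist G p (fst p, Y) + gdist G (fst p, Y) (X, Y)"
      by (rule gdist_triangle[OF G p C m])
    also have "gdist G p (fst p, Y) \<le> \<bar>snd p - Y\<bar>"
      using gdist_along_aisle[OF i'(1), of "snd p" Y] i'(2) gb XY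
      by (metis atLeastAtMost_iff fst_conv)
    also have "gdist G (fst p, Y) (X, Y) \<le> \<bar>fst p - X\<bar>"
      unfolding k(2) using gb XY by (intro gdist_along_cross_aisle[OF k(1)]) auto
    finally show ?thesis by simp
  next
    case False
    then have "p \<in> cross_aisles G" using p unfolding grid_def by blast
    then obtain k' where k': "k' < cross_count G" "p = (fst p, cross_pos G k')"
      unfolding cross_aisles_iff by (cases p) auto
    have m: "(X, snd p) \<in> grid G" using aisle_in_grid[OF i(1)] i(2) gb by auto
    have "gdist G p (X, Y) \<le> gdist G p (X, snd p) + gdist G (X, snd p) (X, Y)"
      by (rule gdist_triangle[OF G p C m])
    also have "gdist G p (X, snd p) \<le> \<bar>fst p - X\<bar>"
      using gdist_along_cross_aisle[OF k'(1), of "fst p" X] k'(2) gb XY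
      by (metis atLeastAtMost_iff snd_conv)
    also have "gdist G (X, snd p) (X, Y) \<le> \<bar>snd p - Y\<bar>"
      unfolding i(2) using gb XY by (intro gdist_along_aisle[OF i(1)]) auto
    finally show ?thesis by simp
  qed
qed

section \<open>A short walk through all aisles\<close>

fun walk_length :: "warehouse \<Rightarrow> point \<Rightarrow> point list \<Rightarrow> point \<Rightarrow> real" where
  "walk_length G p [] q = gdist G p q"
| "walk_length G p (l # ls) q = gdist G p l + walk_length G l ls q"

lemma walk_nonneg:
  assumes "valid_warehouse G" "p \<in> grid G" "q \<in> grid G" "set ls \<subseteq> grid G"
  shows "0 \<le> walk_length G p ls q"
  using assms by (induction ls arbitrary: p) (auto intro!: gdist_nonneg add_nonneg_nonneg)

lemma walk_start:
  assumes "valid_warehouse G" "p \<in> grid G" "m \<in> grid G" "q \<in> grid G" "set ls \<subseteq> grid G"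
  shows "walk_length G p ls q \<le> gdist G p m + walk_length G m ls q"
  using assms gdist_triangle[of G p _ m] by (cases ls) (auto simp: add.assoc[symmetric])

lemma walk_append:
  assumes "valid_warehouse G" "p \<in> grid G" "m \<in> grid G" "q \<in> grid G"
    "set ls \<subseteq> grid G" "set ls' \<subseteq> grid G"
  shows "walk_length G p (ls @ ls') q \<le> walk_length G p ls m + walk_length G m ls' q"
  using assms by (induction ls arbitrary: p) (auto intro: walk_start)

text \<open>
  The sign \<open>s\<close> treats the upward and the downward direction at once. In either direction the
  hops between consecutive points telescope.
\<close>

lemma walk_monotone_in_aisle:
  fixes s :: real
  assumes i: "i < aisle_count G" and s: "s = 1 \<or> s = -1"
    and ls: "\<forall>l\<in>set ls. fst l = aisle_pos G i \<and> snd l \<in> {0..width G} \<and> s * snd l \<le> s * y'"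
    and sorted: "sorted (map (\<lambda>l. s * snd l) ls)"
    and y: "y \<in> {0..width G}" "y' \<in> {0..width G}" "\<forall>l\<in>set ls. s * y \<le> s * snd l" "s * y \<le> s * y'"
  shows "walk_length G (aisle_pos G i, y) ls (aisle_pos G i, y') \<le> s * (y' - y)"
  using ls sorted y
proof (induction ls arbitrary: y)
  case Nil
  then show ?case using gdist_along_aisle[OF i, of y y'] s by auto
next
  case (Cons l ls)
  obtain z where l: "l = (aisle_pos G i, z)" using Cons.prems(1) by (cases l) auto
  have "walk_length G l ls (aisle_pos G i, y') \<le> s * (y' - z)"
    unfolding l using Cons.prems l by (intro Cons.IH) auto
  moreover have "gdist G (aisle_pos G i, y) l \<le> s * (z - y)"
    unfolding l using gdist_along_aisle[OF i, of y z] Cons.prems l s by auto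
  ultimately show ?case by (simp add: algebra_simps)
qed

lemma walk_through_aisle:
  assumes "0 \<le> width G" and i: "i < aisle_count G" and h: "h = 0 \<or> h = width G"
    and X: "finite X" "\<forall>x\<in>X. fst (snd x) = aisle_pos G i \<and> snd (snd x) \<in> {0..width G}"
  shows "\<exists>b. set b = X \<and> distinct b \<and>
    walk_length G (aisle_pos G i, h) (map snd b) (aisle_pos G i, width G - h) \<le> width G"
proof -
  obtain xs where xs: "set xs = X" "distinct xs" using finite_distinct_list[OF X(1)] by blast
  define s :: real where "s = (if h = 0 then 1 else -1)"
  define b where "b = sort_key (\<lambda>x. s * snd (snd x)) xs"
  have b: "set b = X" "distinct b" "sorted (map (\<lambda>x. s * snd (snd x)) b)"
    unfolding b_def using xs by auto
  have "walk_length G (aisle_pos G i, h) (map snd b) (aisle_pos G i, width G - h) \<le> s * (width G - h - h)"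
    using X(2) assms(1) h b(3)
    by (intro walk_monotone_in_aisle[OF i]) (auto simp: s_def b(1) o_def)
  also have "\<dots> = width G" using h by (auto simp: s_def)
  finally show ?thesis using b by blast
qed

text \<open>
  The snake visits the aisles in the order \<open>g\<close>, entering the \<open>i\<close>-th one at height \<open>h i\<close>
  and leaving it at the opposite end, which is the height at which the next one is entered. Each aisle
  contributes a full width, each change of aisle one gap between neighbouring aisles.
\<close>

lemma snake_walk:
  assumes G: "valid_warehouse G"
    and g: "bij_betw g {..<aisle_count G} {..<aisle_count G}"
      "\<And>i. Suc i < aisle_count G \<Longrightarrow>
        \<bar>aisle_pos G (g i) - aisle_pos G (g (Suc i))\<bar> = len G / real (aisle_count G - 1)"
    and h: "h 0 = 0 \<or> h 0 = width G" "\<And>i. h (Suc i) = width G - h i"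
    and k: "k < aisle_count G"
    and X: "finite X" "\<forall>x\<in>X. (\<exists>i\<le>k. fst (snd x) = aisle_pos G (g i)) \<and> snd (snd x) \<in> {0..width G}"
  shows "\<exists>b. set b = X \<and> distinct b \<and>
    walk_length G (aisle_pos G (g 0), h 0) (map snd b) (aisle_pos G (g k), h (Suc k))
      \<le> real (Suc k) * width G + real k * len G / real (aisle_count G - 1)"
  using k X
proof (induction k arbitrary: X)
  case 0
  have g0: "g 0 < aisle_count G" using g(1) 0(1) unfolding bij_betw_def by auto
  show ?case
    using walk_through_aisle[OF _ g0 h(1) 0(2)] 0(3) valid_warehouse_bounds(1)[OF G] h(2) by simp
next
  case (Suc k)
  note b = valid_warehouse_bounds[OF G]
  have gi: "g i < aisle_count G" if "i \<le> Suc k" for i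
    using g(1) that Suc.prems(1) unfolding bij_betw_def by auto
  have hW: "h i = 0 \<or> h i = width G" for i using h by (induction i) auto
  then have h01: "h i \<in> {0..width G}" for i using b(1) by (metis atLeastAtMost_iff less_eq_real_def)
  have corner: "(aisle_pos G (g i), h j) \<in> grid G" if "i \<le> Suc k" for i j
    using aisle_in_grid[OF gi[OF that]] h01[of j] by auto
  let ?Z = "{x \<in> X. fst (snd x) = aisle_pos G (g (Suc k))}"
  have "\<forall>x\<in>X - ?Z. (\<exists>i\<le>k. fst (snd x) = aisle_pos G (g i)) \<and> snd (snd x) \<in> {0..width G}"
    using Suc.prems(3) by (auto simp: le_Suc_eq)
  then obtain b1 where b1: "set b1 = X - ?Z" "distinct b1"
    "walk_length G (aisle_pos G (g 0), h 0) (map snd b1) (aisle_pos G (g k), h (Suc k))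
      \<le> real (Suc k) * width G + real k * len G / real (aisle_count G - 1)"
    using Suc.IH[of "X - ?Z"] Suc.prems by auto
  have "\<forall>x\<in>?Z. fst (snd x) = aisle_pos G (g (Suc k)) \<and> snd (snd x) \<in> {0..width G}"
    using Suc.prems(3) by auto
  moreover have "finite ?Z" using Suc.prems(2) by simp
  ultimately obtain b2 where b2: "set b2 = ?Z" "distinct b2"
    "walk_length G (aisle_pos G (g (Suc k)), h (Suc k)) (map snd b2)
       (aisle_pos G (g (Suc k)), h (Suc (Suc k))) \<le> width G"
    using walk_through_aisle[OF less_imp_le[OF b(1)] gi[OF order.refl] hW[of "Suc k"], of ?Z,
        folded h(2)[of "Suc k"]] by blast
  have inG: "snd ` X \<subseteq> grid G"
  proof
    fix p assume "p \<in> snd ` X"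
    then obtain i where "i \<le> Suc k" "fst p = aisle_pos G (g i)" "snd p \<in> {0..width G}"
      using Suc.prems(3) by auto
    then show "p \<in> grid G" using aisle_in_grid[of "g i" G "snd p"] gi[of i] by (cases p) auto
  qed
  have s: "set (map snd b1) \<subseteq> grid G" "set (map snd b2) \<subseteq> grid G" using inG b1(1) b2(1) by auto
  obtain m where m: "m < cross_count G" "h (Suc k) = cross_pos G m"
    using hW[of "Suc k"] border_cross_aisles[OF G] b
    by (metis diff_less less_le_trans zero_less_one zero_less_numeral)
  have ax: "aisle_pos G (g i) \<in> {0..len G}" if "i \<le> Suc k" for i
    using grid_bounds[OF G corner[OF that]] by auto
  have hop: "gdist G (aisle_pos G (g k), h (Suc k)) (aisle_pos G (g (Suc k)), h (Suc k))
      \<le> len G / real (aisle_count G - 1)"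
    using gdist_along_cross_aisle[OF m(1) ax[of k] ax[of "Suc k"]] g(2)[OF Suc.prems(1)] m(2) by simp
  have "walk_length G (aisle_pos G (g 0), h 0) (map snd b1 @ map snd b2)
      (aisle_pos G (g (Suc k)), h (Suc (Suc k)))
    \<le> walk_length G (aisle_pos G (g 0), h 0) (map snd b1) (aisle_pos G (g k), h (Suc k)) +
      walk_length G (aisle_pos G (g k), h (Suc k)) (map snd b2) (aisle_pos G (g (Suc k)), h (Suc (Suc k)))"
    by (rule walk_append) (use G corner s in auto)
  also have "walk_length G (aisle_pos G (g k), h (Suc k)) (map snd b2)
        (aisle_pos G (g (Suc k)), h (Suc (Suc k)))
    \<le> gdist G (aisle_pos G (g k), h (Suc k)) (aisle_pos G (g (Suc k)), h (Suc k)) +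
      walk_length G (aisle_pos G (g (Suc k)), h (Suc k)) (map snd b2)
        (aisle_pos G (g (Suc k)), h (Suc (Suc k)))"
    by (rule walk_start) (use G corner s in auto)
  finally have "walk_length G (aisle_pos G (g 0), h 0) (map snd (b1 @ b2))
      (aisle_pos G (g (Suc k)), h (Suc (Suc k)))
    \<le> real (Suc (Suc k)) * width G + real (Suc k) * len G / real (aisle_count G - 1)"
    using hop b1(3) b2(3) by (simp add: algebra_simps add_divide_distrib)
  moreover have "set (b1 @ b2) = X" "distinct (b1 @ b2)" using b1 b2 by auto
  ultimately show ?case by blast
qed

definition tour_bound :: "warehouse \<Rightarrow> real" where
  "tour_bound G = (real (aisle_count G) + 1) * width G + 2 * len G"

text \<open>
  The snake may start at the left or at the right and at the bottom or at the top. It costs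
  \<open>a * W + L\<close>; the rest is the way from \<open>p\<close> to its first and from its last corner to \<open>q\<close>. Horizontally
  these two ways sum to \<open>(p\<^sub>x + L - q\<^sub>x) + (L - p\<^sub>x + q\<^sub>x) = 2 * L\<close> over the two choices of the first aisle.
  Vertically, swapping top and bottom complements both heights, so the sum over the two choices is
  \<open>2 * W\<close>, whatever the parity of the number of aisles. The better choice in each direction
  thus adds at most \<open>L + W\<close>.
\<close>

lemma walk_through_all_aisles:
  fixes X :: "item set"
  assumes G: "valid_warehouse G" and p: "p \<in> grid G" and q: "q \<in> grid G"
    and X: "finite X" "snd ` X \<subseteq> aisles G"
  shows "\<exists>b. set b = X \<and> distinct b \<and> walk_length G p (map snd b) q \<le> tour_bound G"
proof -
  note b = valid_warehouse_bounds[OF G]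
  let ?a = "aisle_count G"
  define g where "g mirror i = (if mirror then ?a - 1 - i else i)" for mirror i
  define h where "h flip i = (if even i = flip then width G else 0)" for flip :: bool and i :: nat
  have tour: "\<exists>b. set b = X \<and> distinct b \<and> walk_length G p (map snd b) q
      \<le> real ?a * width G + len G
        + \<bar>fst p - aisle_pos G (g f 0)\<bar> + \<bar>fst q - aisle_pos G (g f (?a - 1))\<bar>
        + \<bar>snd p - h e 0\<bar> + \<bar>snd q - h e ?a\<bar>" for e f
  proof -
    have bij: "bij_betw (g f) {..<?a} {..<?a}"
      by (rule bij_betw_byWitness[where f' = "g f"]) (use b in \<open>auto simp: g_def\<close>)
    have gap: "\<bar>aisle_pos G (g f i) - aisle_pos G (g f (Suc i))\<bar> = len G / real (?a - 1)"
      if "Suc i < ?a" for i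
    proof -
      have "real (g f i) - real (g f (Suc i)) = (if f then 1 else -1)"
        using that by (auto simp: g_def of_nat_diff)
      moreover have "aisle_pos G (g f i) - aisle_pos G (g f (Suc i)) =
          (real (g f i) - real (g f (Suc i))) * (len G / real (?a - 1))"
        by (simp add: aisle_pos_def diff_divide_distrib left_diff_distrib)
      ultimately show ?thesis using b(2) by auto
    qed
    have "\<forall>x\<in>X. (\<exists>i\<le>?a - 1. fst (snd x) = aisle_pos G (g f i)) \<and> snd (snd x) \<in> {0..width G}"
    proof
      fix x assume "x \<in> X"
      then have "snd x \<in> aisles G" using X(2) by auto
      then obtain j where j: "j < ?a" "fst (snd x) = aisle_pos G j" "snd (snd x) \<in> {0..width G}"
        unfolding aisles_iff by auto
      moreover have "g f (g f j) = j" "g f j \<le> ?a - 1" using j(1) by (auto simp: g_def)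
      ultimately show "(\<exists>i\<le>?a - 1. fst (snd x) = aisle_pos G (g f i)) \<and> snd (snd x) \<in> {0..width G}"
        by metis
    qed
    moreover have "h e (Suc i) = width G - h e i" "h e 0 = 0 \<or> h e 0 = width G" for i
      by (auto simp: h_def)
    moreover have "?a - 1 < ?a" "Suc (?a - 1) = ?a" using b by auto
    ultimately obtain bb where bb: "set bb = X" "distinct bb"
      "walk_length G (aisle_pos G (g f 0), h e 0) (map snd bb) (aisle_pos G (g f (?a - 1)), h e ?a)
        \<le> real ?a * width G + real (?a - 1) * len G / real (?a - 1)"
      using snake_walk[OF G bij gap, of "h e" "?a - 1" X] X(1) by metis
    have "real (?a - 1) * len G / real (?a - 1) = len G"
      using G unfolding valid_warehouse_def by auto
    note bb = bb(1,2) bb(3)[unfolded this]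
    have gX: "aisle_pos G (g f 0) = 0 \<or> aisle_pos G (g f 0) = len G"
      "aisle_pos G (g f (?a - 1)) = 0 \<or> aisle_pos G (g f (?a - 1)) = len G"
      using border_aisles[OF G] by (auto simp: g_def)
    have hY: "h e i = 0 \<or> h e i = width G" for i by (auto simp: h_def)
    have cg: "(aisle_pos G (g f i), h e j) \<in> grid G" if "i < ?a" for i j
      using aisle_in_grid[of "g f i" G "h e j"] that hY[of j] b by (auto simp: g_def)
    have s: "set (map snd bb) \<subseteq> grid G" using bb X unfolding grid_def by auto
    let ?A = "(aisle_pos G (g f 0), h e 0)" and ?B = "(aisle_pos G (g f (?a - 1)), h e ?a)"
    have AB: "?A \<in> grid G" "?B \<in> grid G" using cg b by auto
    have "walk_length G p (map snd bb @ []) q \<le> walk_length G p (map snd bb) ?B + walk_length G ?B [] q"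
      by (rule walk_append) (use G p q s AB in auto)
    also have "walk_length G p (map snd bb) ?B \<le> gdist G p ?A + walk_length G ?A (map snd bb) ?B"
      by (rule walk_start) (use G p q s AB in auto)
    finally have "walk_length G p (map snd bb) q
        \<le> gdist G p ?A + walk_length G ?A (map snd bb) ?B + gdist G q ?B"
      by (simp add: gdist_commute)
    then have "walk_length G p (map snd bb) q
      \<le> real ?a * width G + len G
        + \<bar>fst p - aisle_pos G (g f 0)\<bar> + \<bar>fst q - aisle_pos G (g f (?a - 1))\<bar>
        + \<bar>snd p - h e 0\<bar> + \<bar>snd q - h e ?a\<bar>"
      using gdist_corner[OF G p gX(1) hY[of 0]] gdist_corner[OF G q gX(2) hY[of ?a]] bb(3) by simp
    then show ?thesis using bb by blast
  qed
  note gp = grid_bounds[OF G p] and gq = grid_bounds[OF G q]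
  have "\<exists>f. \<bar>fst p - aisle_pos G (g f 0)\<bar> + \<bar>fst q - aisle_pos G (g f (?a - 1))\<bar> \<le> len G"
    using gp gq border_aisles[OF G]
    by (cases "fst p \<le> fst q") (auto simp: g_def intro: exI[of _ False] exI[of _ True])
  moreover have "\<exists>e. \<bar>snd p - h e 0\<bar> + \<bar>snd q - h e ?a\<bar> \<le> width G"
  proof (rule ccontr)
    assume "\<not> ?thesis"
    then have "\<bar>snd p - h e 0\<bar> + \<bar>snd q - h e ?a\<bar> > width G" for e by (simp add: not_le)
    from this[of True] this[of False] show False using gp gq by (auto simp: h_def split: if_splits)
  qed
  ultimately obtain e f where ef:
    "\<bar>fst p - aisle_pos G (g f 0)\<bar> + \<bar>fst q - aisle_pos G (g f (?a - 1))\<bar> \<le> len G"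
    "\<bar>snd p - h e 0\<bar> + \<bar>snd q - h e ?a\<bar> \<le> width G" by blast
  obtain bb where bb: "set bb = X" "distinct bb" "walk_length G p (map snd bb) q
      \<le> real ?a * width G + len G
        + \<bar>fst p - aisle_pos G (g f 0)\<bar> + \<bar>fst q - aisle_pos G (g f (?a - 1))\<bar>
        + \<bar>snd p - h e 0\<bar> + \<bar>snd q - h e ?a\<bar>"
    using tour by blast
  have "walk_length G p (map snd bb) q \<le> tour_bound G"
    using bb(3) ef unfolding tour_bound_def by (simp add: algebra_simps)
  then show ?thesis using bb by blast
qed

section \<open>Comparing completion times\<close>

abbreviation batches_steps :: "batch list \<Rightarrow> step list" where
  "batches_steps bs \<equiv> concat (map batch_steps bs)"

lemma Pick_in_batch_steps: "Pick j l \<in> set (batch_steps b) \<longleftrightarrow> (j, l) \<in> set b"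
  unfolding batch_steps_def by auto

lemma Pick_in_batches_steps: "Pick j l \<in> set (batches_steps bs) \<longleftrightarrow> (j, l) \<in> set (concat bs)"
  using Pick_in_batch_steps by auto

definition steps_in_grid :: "warehouse \<Rightarrow> step list \<Rightarrow> bool" where
  "steps_in_grid G xs \<longleftrightarrow> (\<forall>j l. Pick j l \<in> set xs \<longrightarrow> l \<in> grid G)"

lemma steps_in_grid_simps [simp]:
  "steps_in_grid G []"
  "steps_in_grid G (Pick j l # xs) \<longleftrightarrow> l \<in> grid G \<and> steps_in_grid G xs"
  "steps_in_grid G (End_batch # xs) \<longleftrightarrow> steps_in_grid G xs"
  "steps_in_grid G (xs @ ys) \<longleftrightarrow> steps_in_grid G xs \<and> steps_in_grid G ys"
  unfolding steps_in_grid_def by (auto simp del: split_paired_All)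

lemma steps_in_grid_batches: "snd ` set (concat bs) \<subseteq> grid G \<Longrightarrow> steps_in_grid G (batches_steps bs)"
  unfolding steps_in_grid_def Pick_in_batches_steps by (auto simp del: set_concat)

lemma dest_in_grid:
  "valid_warehouse G \<Longrightarrow> p \<in> grid G \<Longrightarrow> steps_in_grid G (x # xs) \<Longrightarrow> dest sys G p x \<in> grid G"
  by (cases x) (auto simp: valid_warehouse_def)

text \<open>
  Omitting steps, starting earlier or nearer, and having items available earlier cannot delay
  the completion. The invariant is that the faster picker could join the slower one in time. It
  is kept when only the slower one moves, by the triangle inequality, and when both perform the same
  step: they then meet, or, when a robot is exchanged, both stay where they are.
\<close>

lemma completion_mono:
  assumes "valid_warehouse G" "subseq ys xs" "\<And>j l. Pick j l \<in> set xs \<Longrightarrow> r j \<le> r' j"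
    "p \<in> grid G" "q \<in> grid G" "steps_in_grid G xs" "t + gdist G p q \<le> t'"
  shows "completion sys G r t p ys \<le> completion sys G r' t' q xs"
  using assms(2-)
proof (induction xs arbitrary: ys t p t' q rule: list.induct)
  case Nil
  then show ?case using gdist_nonneg[OF assms(1), of p q] by (cases ys) auto
next
  case (Cons x xs)
  note G = assms(1)
  define q' where "q' = dest sys G q x"
  define t'' where "t'' = (case x of Pick j l \<Rightarrow> max (t' + gdist G q q') (r' j) | End_batch \<Rightarrow> t' + gdist G q q')"
  have q': "q' \<in> grid G" unfolding q'_def by (rule dest_in_grid[OF G Cons.prems(4,5)])
  have xs: "steps_in_grid G xs" using Cons.prems(5) by (cases x) auto
  have arr: "r j \<le> r' j" if "Pick j l \<in> set xs" for j l
    using Cons.prems(2)[of j l] that by simp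
  have t'': "t' + gdist G q q' \<le> t''" unfolding t''_def by (cases x) auto
  have rhs: "completion sys G r' t' q (x # xs) = completion sys G r' t'' q' xs"
    unfolding t''_def q'_def completion.simps Let_def ..
  show ?case
  proof (cases "subseq ys xs")
    case True
    have le: "t + gdist G p q' \<le> t''"
      using gdist_triangle[OF G Cons.prems(3) q' Cons.prems(4)] Cons.prems(6) t'' by linarith
    show ?thesis unfolding rhs by (rule Cons.IH[OF True _ Cons.prems(3) q' xs le]) (rule arr)
  next
    case False
    then obtain ys' where ys: "ys = x # ys'" "subseq ys' xs"
      using Cons.prems(1) by (cases ys) (auto split: if_splits)
    define p' where "p' = dest sys G p x"
    define s where "s = (case x of Pick j l \<Rightarrow> max (t + gdist G p p') (r j) | End_batch \<Rightarrow> t + gdist G p p')"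
    have p': "p' \<in> grid G" unfolding p'_def by (rule dest_in_grid[OF G Cons.prems(3,5)])
    have lhs: "completion sys G r t p ys = completion sys G r s p' ys'"
      unfolding ys(1) s_def p'_def completion.simps Let_def ..
    have tr: "gdist G p q' \<le> gdist G p q + gdist G q q'"
      by (rule gdist_triangle[OF G Cons.prems(3) q' Cons.prems(4)])
    have le: "s + gdist G p' q' \<le> t''"
    proof (cases x)
      case (Pick j l)
      have "p' = q'" "gdist G p' q' = 0"
        using Pick p' q' gdist_refl[OF G] by (auto simp: p'_def q'_def)
      then show ?thesis using tr Cons.prems(6) Cons.prems(2)[of j l] Pick
        by (auto simp: s_def t''_def)
    next
      case End_batch
      show ?thesis
      proof (cases "sys = Robot")
        case True
        then have "p' = p" "q' = q" using End_batch by (auto simp: p'_def q'_def)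
        then show ?thesis
          using Cons.prems End_batch gdist_refl[OF G] by (auto simp: s_def t''_def)
      next
        case False
        then have "p' = q'" "gdist G p' q' = 0"
          using End_batch p' q' gdist_refl[OF G] by (auto simp: p'_def q'_def)
        then show ?thesis using tr Cons.prems(6) End_batch by (auto simp: s_def t''_def)
      qed
    qed
    show ?thesis unfolding lhs rhs by (rule Cons.IH[OF ys(2) _ p' q' xs le]) (rule arr)
  qed
qed

lemma completion_ge_start:
  assumes "valid_warehouse G" "p \<in> grid G" "steps_in_grid G xs"
  shows "t \<le> completion sys G r t p xs"
  using completion_mono[OF assms(1), of "[]" xs r r p p t t sys] assms gdist_refl[of G p] by simp

lemma completion_ge_arrival:
  assumes "valid_warehouse G" "p \<in> grid G" "steps_in_grid G xs" "Pick j l \<in> set xs"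
  shows "r j \<le> completion sys G r t p xs"
proof -
  have "subseq [Pick j l] xs" using assms(4) by (simp add: subseq_singleton_left)
  then have "completion sys G r t p [Pick j l] \<le> completion sys G r t p xs"
    using assms gdist_refl[of G p] by (intro completion_mono) auto
  then show ?thesis by simp
qed

lemma completion_add_start:
  assumes "valid_warehouse G" "p \<in> grid G" "steps_in_grid G xs" "0 \<le> s" "0 \<le> t"
  shows "completion sys G (\<lambda>_. 0) (s + t) p xs = s + completion sys G (\<lambda>_. 0) t p xs"
  using assms(2,3,5)
proof (induction xs arbitrary: p t)
  case (Cons x xs)
  define q where "q = dest sys G p x"
  have q: "q \<in> grid G" unfolding q_def by (rule dest_in_grid[OF assms(1) Cons.prems(1,2)])
  have d: "0 \<le> gdist G p q" by (rule gdist_nonneg[OF assms(1) Cons.prems(1) q])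
  have xs: "steps_in_grid G xs" using Cons.prems(2) by (cases x) auto
  have "completion sys G (\<lambda>_. 0) (s + (t + gdist G p q)) q xs
      = s + completion sys G (\<lambda>_. 0) (t + gdist G p q) q xs"
    using Cons.prems d by (intro Cons.IH[OF q xs]) auto
  then show ?case
    using d Cons.prems(3) assms(4) by (cases x) (simp_all add: q_def Let_def add.assoc)
qed simp

text \<open>
  A robot picker need not visit the depot after a batch; the detour through it is an upper bound
  that serves all systems alike.
\<close>

lemma completion_batch_le:
  assumes G: "valid_warehouse G" and "p \<in> grid G" "snd ` set b \<subseteq> grid G"
    "steps_in_grid G rest" "0 \<le> t"
  shows "completion sys G (\<lambda>_. 0) t p (batch_steps b @ rest)
    \<le> completion sys G (\<lambda>_. 0) (t + walk_length G p (map snd b) (depot G)) (depot G) rest"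
  using assms(2-)
proof (induction b arbitrary: p t)
  case Nil
  have d: "depot G \<in> grid G" using valid_warehouse_bounds[OF G] by simp
  show ?case
    by (cases "sys = Robot")
       (use Nil d gdist_refl[OF G] in \<open>auto simp: batch_steps_def Let_def intro!: completion_mono[OF G]\<close>)
next
  case (Cons x b)
  obtain j l where x: "x = (j, l)" by (cases x)
  have l: "l \<in> grid G" using Cons.prems(2) x by auto
  have "0 \<le> gdist G p l" by (rule gdist_nonneg[OF G Cons.prems(1) l])
  then show ?case
    using Cons.IH[OF l, of "t + gdist G p l"] Cons.prems x
    by (auto simp: batch_steps_def Let_def add.assoc)
qed

lemma completion_batch_pushcart:
  assumes G: "valid_warehouse G" and sys: "sys \<noteq> Robot" and "p \<in> grid G" "snd ` set b \<subseteq> grid G"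
    "0 \<le> t"
  shows "completion sys G (\<lambda>_. 0) t p (batch_steps b @ rest)
    = completion sys G (\<lambda>_. 0) (t + walk_length G p (map snd b) (depot G)) (depot G) rest"
  using assms(3-)
proof (induction b arbitrary: p t)
  case Nil
  then show ?case using sys by (simp add: batch_steps_def Let_def)
next
  case (Cons x b)
  obtain j l where x: "x = (j, l)" by (cases x)
  have l: "l \<in> grid G" using Cons.prems(2) x by auto
  have "0 \<le> gdist G p l" by (rule gdist_nonneg[OF G Cons.prems(1) l])
  then show ?case
    using Cons.IH[OF l, of "t + gdist G p l"] Cons.prems x
    by (auto simp: batch_steps_def Let_def add.assoc)
qed

definition round_trip :: "warehouse \<Rightarrow> batch \<Rightarrow> real" where
  "round_trip G b = walk_length G (depot G) (map snd b) (depot G)"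

lemma round_trip_nonneg:
  assumes "valid_warehouse G" "snd ` set b \<subseteq> grid G" shows "0 \<le> round_trip G b"
  unfolding round_trip_def using assms valid_warehouse_bounds(5) by (auto intro!: walk_nonneg)

text \<open>
  A pushcart schedule decomposes into independent round trips, as every batch starts and ends at the
  depot.
\<close>

lemma completion_round_trips:
  assumes G: "valid_warehouse G" and sys: "sys \<noteq> Robot" and "snd ` set (concat bs) \<subseteq> grid G" "0 \<le> t"
  shows "completion sys G (\<lambda>_. 0) t (depot G) (batches_steps bs)
    = t + sum_list (map (round_trip G) bs)"
  using assms(3-)
proof (induction bs arbitrary: t)
  case (Cons b bs)
  have b: "snd ` set b \<subseteq> grid G" using Cons.prems(1) by auto
  show ?case
    using completion_batch_pushcart[OF G sys _ b Cons.prems(2)] valid_warehouse_bounds(5)[OF G]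
      Cons.IH[of "t + round_trip G b"] Cons.prems round_trip_nonneg[OF G b]
    by (simp add: round_trip_def add.assoc image_Un)
qed simp

section \<open>Reoptimization plans and the offline optimum\<close>

lemma items_in_aisles: "valid_instance G c os \<Longrightarrow> snd ` items os \<subseteq> aisles G"
  unfolding valid_instance_def valid_orders_def items_def
  by (auto simp: split_beta dest!: nth_mem) blast

lemma CIOPT_attained_in_grid:
  assumes I: "valid_instance G c os"
  obtains bs where "solution c os bs" "steps_in_grid G (batches_steps bs)"
    "CIOPT sys G c os = completion sys G (\<lambda>j. fst (os ! j)) 0 (depot G) (batches_steps bs)"
proof -
  obtain bs where bs: "solution c os bs" "CIOPT sys G c os =
      completion sys G (\<lambda>j. fst (os ! j)) 0 (depot G) (batches_steps bs)"
    using CIOPT_attained[OF I] by blast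
  have "set (concat bs) = items os" using bs(1) unfolding solution_def by simp
  then have "steps_in_grid G (batches_steps bs)"
    by (intro steps_in_grid_batches) (use items_in_aisles[OF I] in \<open>auto simp: grid_def\<close>)
  then show thesis using that bs by blast
qed

lemma CIOPT_ge_arrival:
  assumes I: "valid_instance G c os" and j: "j < length os"
  shows "fst (os ! j) \<le> CIOPT sys G c os"
proof -
  have G: "valid_warehouse G" using I unfolding valid_instance_def by simp
  obtain bs where bs: "solution c os bs" "steps_in_grid G (batches_steps bs)" "CIOPT sys G c os =
      completion sys G (\<lambda>j. fst (os ! j)) 0 (depot G) (batches_steps bs)"
    using CIOPT_attained_in_grid[OF I] by blast
  have "snd (os ! j) \<noteq> {}"
    using I j nth_mem[OF j] unfolding valid_instance_def valid_orders_def by (auto simp: split_beta)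
  then obtain l where "(j, l) \<in> items os" using j unfolding items_def by auto
  then have "Pick j l \<in> set (batches_steps bs)"
    unfolding Pick_in_batches_steps using bs(1) unfolding solution_def by simp
  then show ?thesis unfolding bs(3)
    by (intro completion_ge_arrival[OF G valid_warehouse_bounds(5)[OF G] bs(2)])
qed

lemma CIOPT_nonneg:
  assumes I: "valid_instance G c os"
  shows "0 \<le> CIOPT sys G c os"
proof -
  have G: "valid_warehouse G" using I unfolding valid_instance_def by simp
  obtain bs where bs: "steps_in_grid G (batches_steps bs)" "CIOPT sys G c os =
      completion sys G (\<lambda>j. fst (os ! j)) 0 (depot G) (batches_steps bs)"
    using CIOPT_attained_in_grid[OF I] by blast
  show ?thesis unfolding bs(2)
    by (rule completion_ge_start[OF G valid_warehouse_bounds(5)[OF G] bs(1)])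
qed

lemma subseq_batches_steps_filter:
  "subseq (batches_steps (filter (\<lambda>b. b \<noteq> []) (map (filter P) bs))) (batches_steps bs)"
proof (induction bs)
  case (Cons b bs)
  have "subseq (batch_steps (filter P b)) (batch_steps b)"
    unfolding batch_steps_def by (intro list_emb_append_mono subseq_map subseq_filter_left) auto
  then show ?case using Cons by (auto intro: list_emb_append_mono list_emb_append2)
qed simp

lemma concat_filter_nonempty: "concat (filter (\<lambda>b. b \<noteq> []) bs) = concat bs"
  by (induction bs) auto

lemma restrict_solution:
  fixes P :: "item \<Rightarrow> bool"
  assumes "solution c os bs"
  defines "fut \<equiv> filter (\<lambda>b. b \<noteq> []) (map (filter P) bs)"
  shows "[] \<notin> set fut" "distinct (concat fut)" "set (concat fut) = {x \<in> items os. P x}"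
    "disjoint_batches fut" "\<forall>b\<in>set fut. card (batch_orders b) \<le> c"
proof -
  have eq: "concat fut = filter P (concat bs)"
    unfolding fut_def concat_filter_nonempty by (simp add: filter_concat)
  show "distinct (concat fut)" "set (concat fut) = {x \<in> items os. P x}"
    unfolding eq using assms(1) unfolding solution_def by auto
  have "disjoint_batches (map (filter P) bs)"
    unfolding sorted_wrt_map
    by (rule sorted_wrt_mono_rel[of bs "\<lambda>b b'. batch_orders b \<inter> batch_orders b' = {}"])
       (use assms(1) in \<open>auto simp: solution_def\<close>)
  then show "disjoint_batches fut" unfolding fut_def by (rule sorted_wrt_filter)
  have "card (batch_orders (filter P b)) \<le> c" if "b \<in> set bs" for b
  proof -
    have "card (batch_orders (filter P b)) \<le> card (batch_orders b)" by (rule card_mono) auto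
    then show ?thesis using assms(1) that unfolding solution_def by fastforce
  qed
  then show "\<forall>b\<in>set fut. card (batch_orders b) \<le> c" unfolding fut_def by auto
qed (auto simp: fut_def)

text \<open>
  The plan compared with completes the current cart in the order \<open>cur\<close> and then follows an
  optimal offline solution, restricted to the orders not yet commenced. For a robot
  the bound also pays for a way to the depot in between, since the offline solution starts there.
\<close>

lemma optimal_plan_cost_le:
  assumes I: "valid_instance G c os" and S: "pos S \<in> grid G" "card (cart S) \<le> c"
    and opt: "optimal_plan sys G c os S pl"
    and cur: "set cur = {x \<in> items os - picked S. fst x \<in> cart S}" "distinct cur"
  shows "plan_cost sys G S pl \<le> walk_length G (pos S) (map snd cur) (depot G) + CIOPT sys G c os"
proof -
  have G: "valid_warehouse G" using I unfolding valid_instance_def by simp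
  note d = valid_warehouse_bounds(5)[OF G]
  have ig: "snd ` items os \<subseteq> grid G" using items_in_aisles[OF I] unfolding grid_def by blast
  obtain bs where bs: "solution c os bs" "CIOPT sys G c os =
      completion sys G (\<lambda>j. fst (os ! j)) 0 (depot G) (batches_steps bs)"
    using CIOPT_attained[OF I] by blast
  define P where "P x \<longleftrightarrow> x \<notin> picked S \<and> fst x \<notin> cart S" for x
  define fut where "fut = filter (\<lambda>b. b \<noteq> []) (map (filter P) bs)"
  note fut = restrict_solution[OF bs(1), of P, folded fut_def]
  have setbs: "set (concat bs) = items os" using bs(1) unfolding solution_def by simp
  have bo: "batch_orders cur \<subseteq> cart S" using cur(1) by auto
  then have un: "cart S \<union> batch_orders cur = cart S" by auto
  have "batch_orders cur \<inter> batch_orders b = {}" if "b \<in> set fut" for b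
  proof -
    have "set b \<subseteq> {x \<in> items os. P x}" using that fut(3) by auto
    then have "batch_orders b \<inter> cart S = {}" unfolding P_def by auto
    then show ?thesis using bo by blast
  qed
  moreover have "set (concat (cur # fut)) = items os - picked S"
    using cur(1) fut(3) unfolding P_def by auto
  moreover have "set cur \<inter> set (concat fut) = {}"
    unfolding fut(3) cur(1) P_def by auto
  ultimately have "feasible_plan c os S (cur, fut)"
    unfolding feasible_plan_def using fut cur S(2) un by (auto simp del: set_concat)
  then have "plan_cost sys G S pl \<le> plan_cost sys G S (cur, fut)"
    using opt unfolding optimal_plan_def by blast
  also have "\<dots> \<le> completion sys G (\<lambda>_. 0) (0 + walk_length G (pos S) (map snd cur) (depot G))
      (depot G) (batches_steps fut)"
    unfolding plan_cost_def plan_steps_def using G S(1) ig cur(1) fut(3)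
    by (simp del: set_concat, intro completion_batch_le[where t = 0, simplified] steps_in_grid_batches)
       auto
  also have "\<dots> = walk_length G (pos S) (map snd cur) (depot G)
      + completion sys G (\<lambda>_. 0) 0 (depot G) (batches_steps fut)"
    using completion_add_start[OF G d, of "batches_steps fut" _ 0 sys] ig cur(1) fut(3)
      walk_nonneg[OF G S(1) d, of "map snd cur"] steps_in_grid_batches[of fut G]
    by (auto simp del: set_concat)
  also have "completion sys G (\<lambda>_. 0) 0 (depot G) (batches_steps fut)
      \<le> CIOPT sys G c os"
    unfolding fut_def bs(2)
  proof (rule completion_mono[OF G subseq_batches_steps_filter])
    show "0 \<le> fst (os ! j)" if "Pick j l \<in> set (batches_steps bs)" for j l
    proof -
      have "os ! j \<in> set os" using that unfolding Pick_in_batches_steps setbs items_def by auto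
      then show ?thesis using I unfolding valid_instance_def valid_orders_def by (auto simp: split_beta)
    qed
  qed (use d gdist_refl[OF G] steps_in_grid_batches[of bs G] setbs ig in auto)
  finally show ?thesis by simp
qed

section \<open>Interventionist reoptimization\<close>

lemma optimal_plan_cost_le_tour:
  assumes I: "valid_instance G c os" and S: "pos S \<in> grid G" "card (cart S) \<le> c"
    and opt: "optimal_plan sys G c os S pl"
  shows "plan_cost sys G S pl \<le> tour_bound G + CIOPT sys G c os"
proof -
  have G: "valid_warehouse G" using I unfolding valid_instance_def by simp
  let ?X = "{x \<in> items os - picked S. fst x \<in> cart S}"
  have "finite ?X" using I finite_items unfolding valid_instance_def by auto
  moreover have "snd ` ?X \<subseteq> aisles G" using items_in_aisles[OF I] by auto
  ultimately obtain cur where cur: "set cur = ?X" "distinct cur"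
    "walk_length G (pos S) (map snd cur) (depot G) \<le> tour_bound G"
    using walk_through_all_aisles[OF G S(1) valid_warehouse_bounds(5)[OF G]] by blast
  then show ?thesis using optimal_plan_cost_le[OF I S opt cur(1,2)] by simp
qed

lemma valid_instance_known:
  assumes "valid_instance G c os" shows "valid_instance G c (known t os)"
proof -
  have "set (known t os) \<subseteq> set os" unfolding known_def using set_takeWhileD by fastforce
  moreover have "sorted (map fst (known t os))"
    using assms sorted_takeWhile[of "map fst os" "\<lambda>r. r \<le> t"]
    unfolding valid_instance_def valid_orders_def known_def by (simp add: takeWhile_map o_def)
  ultimately show ?thesis using assms unfolding valid_instance_def valid_orders_def by blast
qed

lemma known_all:
  "known t os = os \<longleftrightarrow> (\<forall>j<length os. fst (os ! j) \<le> t)"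
  unfolding known_def takeWhile_eq_all_conv all_set_conv_all_nth ..

lemma tie_breaking_ruleD:
  assumes "tie_breaking_rule sys rule" "valid_instance G c ks" "pos S \<in> grid G"
    "finite (cart S)" "card (cart S) \<le> c"
  shows "optimal_plan sys G c ks S (fst (rule G c ks S))" "moves G {0..} (snd (rule G c ks S))"
  using assms(1)[unfolded tie_breaking_rule_def, rule_format, of G c ks S] assms(2-)
  by (simp_all add: split_beta)

text \<open>
  While a plan is followed, the cart never holds orders of more than one of its batches (for the
  first one, in addition to the orders already in the cart), so capacity is respected whenever the next arrival interrupts the plan.
\<close>

lemma follow_cart_batch:
  assumes rest: "\<And>\<Delta> p S. cart S = {} \<Longrightarrow>
      finite (cart (follow sys G \<Delta> p rest S)) \<and> card (cart (follow sys G \<Delta> p rest S)) \<le> c"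
    and "finite (cart S)" "card (cart S \<union> batch_orders b) \<le> c"
  shows "finite (cart (follow sys G \<Delta> p (batch_steps b @ rest) S)) \<and>
    card (cart (follow sys G \<Delta> p (batch_steps b @ rest) S)) \<le> c"
  using assms(2,3)
proof (induction b arbitrary: S p \<Delta>)
  case Nil
  then show ?case using rest by (simp add: batch_steps_def Let_def)
next
  case (Cons x b)
  obtain j l where x: "x = (j, l)" by (cases x)
  have "card (cart S) \<le> card (cart S \<union> batch_orders (x # b))" using Cons.prems by (intro card_mono) auto
  then have "card (cart S) \<le> c" using Cons.prems by linarith
  moreover have "finite (cart (perform (Pick j l) S))"
    "card (cart (perform (Pick j l) S) \<union> batch_orders b) \<le> c"
    using Cons.prems x by auto
  ultimately show ?case using Cons.IH[of "perform (Pick j l) S"] Cons.prems(1) x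
    by (auto simp: batch_steps_def Let_def)
qed

lemma follow_cart_batches:
  assumes "cart S = {}" "\<forall>b\<in>set bs. card (batch_orders b) \<le> c"
  shows "finite (cart (follow sys G \<Delta> p (batches_steps bs) S)) \<and>
    card (cart (follow sys G \<Delta> p (batches_steps bs) S)) \<le> c"
  using assms
proof (induction bs arbitrary: S p \<Delta>)
  case (Cons b bs)
  have "finite (cart (follow sys G \<Delta> p (batch_steps b @ batches_steps bs) S)) \<and>
    card (cart (follow sys G \<Delta> p (batch_steps b @ batches_steps bs) S)) \<le> c"
    by (rule follow_cart_batch) (use Cons in auto)
  then show ?case by simp
qed simp

lemma follow_cart_plan:
  assumes "feasible_plan c ks S pl" "finite (cart S)"
  shows "finite (cart (follow sys G \<Delta> p (plan_steps pl) S)) \<and>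
    card (cart (follow sys G \<Delta> p (plan_steps pl) S)) \<le> c"
proof -
  obtain cur fut where pl: "pl = (cur, fut)" by (cases pl)
  have "finite (cart (follow sys G \<Delta> p (batch_steps cur @ batches_steps fut) S)) \<and>
    card (cart (follow sys G \<Delta> p (batch_steps cur @ batches_steps fut) S)) \<le> c"
    by (intro follow_cart_batch follow_cart_batches) (use assms pl in \<open>auto simp: feasible_plan_def\<close>)
  then show ?thesis unfolding pl plan_steps_def by simp
qed

text \<open>
  The last reoptimization alone determines the bound: earlier ones only have to leave the
  picker in the grid with an admissible cart.
\<close>

lemma run_le:
  assumes rule: "tie_breaking_rule sys rule" and I: "valid_instance G c os"
    and "sorted (clock S # ts)" "\<forall>j<length os. fst (os ! j) \<in> {..last (clock S # ts)}"
    "last (clock S # ts) \<le> T" "pos S \<in> grid G" "finite (cart S)" "card (cart S) \<le> c"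
  shows "run sys rule G c os ts S \<le> T + tour_bound G + CIOPT sys G c os"
  using assms(3-)
proof (induction ts arbitrary: S)
  case Nil
  have k: "known (clock S) os = os" using Nil.prems unfolding known_all by auto
  have "optimal_plan sys G c os S (fst (rule G c os S))"
    by (rule tie_breaking_ruleD[OF rule I Nil.prems(4-)])
  then have "plan_cost sys G S (fst (rule G c os S)) \<le> tour_bound G + CIOPT sys G c os"
    using Nil.prems by (intro optimal_plan_cost_le_tour[OF I])
  then show ?case using Nil.prems(3) by (simp add: k)
next
  case (Cons t ts)
  define ks where "ks = known (clock S) os"
  obtain pl \<tau> where pl: "rule G c ks S = (pl, \<tau>)" by (cases "rule G c ks S")
  have "valid_instance G c ks" unfolding ks_def by (rule valid_instance_known[OF I])
  from tie_breaking_ruleD[OF rule this Cons.prems(4-)]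
  have opt: "optimal_plan sys G c ks S pl" "moves G {0..} \<tau>"
    unfolding pl by simp_all
  define S' where "S' = (follow sys G (t - clock S) (pos S) (plan_steps pl) S)
    \<lparr>clock := t, pos := \<tau> (t - clock S)\<rparr>"
  have "\<tau> (t - clock S) \<in> grid G"
    using opt(2) Cons.prems(1) unfolding moves_def by auto
  moreover have "finite (cart S')" "card (cart S') \<le> c"
    using follow_cart_plan[of c ks S pl] opt(1) Cons.prems(5)
    unfolding S'_def optimal_plan_def by auto
  ultimately have "run sys rule G c os ts S' \<le> T + tour_bound G + CIOPT sys G c os"
    using Cons.prems by (intro Cons.IH) (auto simp: S'_def)
  then show ?case unfolding run.simps Let_def by (simp add: ks_def[symmetric] pl S'_def)
qed

lemma reopt_interv_le:
  assumes rule: "tie_breaking_rule sys rule" and I: "valid_instance G c os"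
  shows "reopt_interv sys rule G c os \<le> 2 * CIOPT sys G c os + tour_bound G"
proof (cases "remdups (map fst os)")
  case Nil
  have "0 \<le> tour_bound G" using I valid_warehouse_bounds[of G]
    unfolding valid_instance_def tour_bound_def by auto
  then show ?thesis using Nil CIOPT_nonneg[OF I, of sys] by (simp add: reopt_interv_def)
next
  case (Cons t ts)
  have G: "valid_warehouse G" using I unfolding valid_instance_def by simp
  have arrivals: "set (t # ts) = fst ` set os" using Cons by (metis set_map set_remdups)
  have sorted: "sorted (t # ts)"
    using I unfolding Cons[symmetric] valid_instance_def valid_orders_def by (auto intro: sorted_remdups)
  have "r \<le> last (t # ts)" if "r \<in> set (t # ts)" for r
  proof -
    have "sorted (butlast (t # ts) @ [last (t # ts)])"
      using sorted by (simp only: append_butlast_last_id[OF list.distinct(2)])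
    moreover have "set (t # ts) = insert (last (t # ts)) (set (butlast (t # ts)))"
      by (metis append_butlast_last_id list.distinct(1) list.simps(15) rotate1.simps(2) set_rotate1)
    ultimately show ?thesis using that unfolding sorted_append by auto
  qed
  then have "\<forall>j<length os. fst (os ! j) \<in> {..last (t # ts)}"
    unfolding arrivals atMost_iff by (metis imageI nth_mem)
  moreover have "last (t # ts) \<le> CIOPT sys G c os"
  proof -
    have "last (t # ts) \<in> fst ` set os" unfolding arrivals[symmetric] by (rule last_in_set) simp
    then show ?thesis using CIOPT_ge_arrival[OF I] by (metis image_iff in_set_conv_nth)
  qed
  ultimately have "run sys rule G c os ts (depot_state G t {})
      \<le> CIOPT sys G c os + tour_bound G + CIOPT sys G c os"
    using sorted valid_warehouse_bounds(5)[OF G]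
    by (intro run_le[OF rule I]) (auto simp: depot_state_def)
  then show ?thesis by (simp add: reopt_interv_def Cons)
qed

section \<open>Non-interventionist reoptimization\<close>

lemma feasible_plan_resequence:
  assumes "feasible_plan c ks S (cur, fut)" "cur # fut = xs @ b # ys" "set b' = set b" "distinct b'"
  shows "\<exists>cur' fut'. cur' # fut' = xs @ b' # ys \<and> feasible_plan c ks S (cur', fut')"
proof (cases xs)
  case Nil
  then show ?thesis using assms
    by (intro exI[of _ b'] exI[of _ ys]) (auto simp: feasible_plan_def)
next
  case (Cons x xs')
  have "b' = [] \<longleftrightarrow> b = []" using assms(3) by auto
  then show ?thesis using assms Cons
    by (intro exI[of _ x] exI[of _ "xs' @ b' # ys"])
       (auto simp: feasible_plan_def sorted_wrt_append)
qed

lemma plan_cost_depot: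
  assumes "valid_warehouse G" "snd ` set (concat (cur # fut)) \<subseteq> grid G" "pos S = depot G"
  shows "plan_cost Pcart_N G S (cur, fut) = sum_list (map (round_trip G) (cur # fut))"
  unfolding plan_cost_def plan_steps_def prod.case assms(3)
  using completion_round_trips[OF assms(1) _ assms(2), of Pcart_N 0] by simp

text \<open>
  Replacing the batch by a pass through the whole warehouse changes the cost of the plan only by
  the difference of the two round trips, so a longer batch would contradict optimality.
\<close>

lemma optimal_plan_round_trip_le:
  assumes I: "valid_instance G c ks" and opt: "optimal_plan Pcart_N G c ks S (cur, fut)"
    and S: "pos S = depot G" and b: "b \<in> set (cur # fut)"
  shows "round_trip G b \<le> tour_bound G"
proof -
  have G: "valid_warehouse G" using I unfolding valid_instance_def by simp
  note d = valid_warehouse_bounds(5)[OF G]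
  have ig: "snd ` items ks \<subseteq> grid G" using items_in_aisles[OF I] unfolding grid_def by blast
  have feas: "feasible_plan c ks S (cur, fut)" using opt unfolding optimal_plan_def by simp
  then have sub: "set (concat (cur # fut)) \<subseteq> items ks" unfolding feasible_plan_def by auto
  obtain xs ys where dec: "cur # fut = xs @ b # ys" using b split_list by metis
  have "set b \<subseteq> items ks" using sub b by auto
  then have "snd ` set b \<subseteq> aisles G" using items_in_aisles[OF I] by auto
  then obtain b' where b': "set b' = set b" "distinct b'" "round_trip G b' \<le> tour_bound G"
    using walk_through_all_aisles[OF G d d, of "set b"] unfolding round_trip_def by auto
  obtain cur' fut' where pl': "cur' # fut' = xs @ b' # ys" "feasible_plan c ks S (cur', fut')"
    using feasible_plan_resequence[OF feas dec b'(1,2)] by blast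
  have sub': "set (concat (cur' # fut')) \<subseteq> items ks" using pl'(2) unfolding feasible_plan_def by auto
  have "plan_cost Pcart_N G S (cur, fut) \<le> plan_cost Pcart_N G S (cur', fut')"
    using opt pl'(2) unfolding optimal_plan_def by blast
  then have "sum_list (map (round_trip G) (cur # fut)) \<le> sum_list (map (round_trip G) (cur' # fut'))"
    using plan_cost_depot[OF G _ S] subset_trans[OF image_mono[OF sub] ig]
      subset_trans[OF image_mono[OF sub'] ig] by metis
  then show ?thesis unfolding dec pl'(1) using b'(3) by simp
qed

text \<open>
  The part of the round invariant that concerns the plan. A plan is kept until new orders arrive, so
  any of its batches may be the one under way when they do: hence a bound on every round trip.
\<close>

fun planned :: "warehouse \<Rightarrow> order list \<Rightarrow> nstate \<Rightarrow> bool" where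
  "planned G os (t, P, bs, ks) \<longleftrightarrow>
     [] \<notin> set bs \<and> distinct (concat bs) \<and> set (concat bs) = items ks - P \<and>
     items ks \<subseteq> items os \<and> (\<forall>b\<in>set bs. round_trip G b \<le> tour_bound G)"

text \<open>
  The part that concerns the clock. As long as the current plan was made without knowing all orders,
  the picker is back at the depot by \<open>C + u\<close>, because she started her last batch before the last
  arrival. Once a plan for all orders has been made, what counts is the time at which it will be
  completed, which no later round changes.
\<close>

fun on_time :: "warehouse \<Rightarrow> order list \<Rightarrow> real \<Rightarrow> nstate \<Rightarrow> bool" where
  "on_time G os C (t, P, bs, ks) \<longleftrightarrow>
     0 \<le> t \<and>
     (if ks = os then (\<forall>j<length os. fst (os ! j) \<le> t) \<and>
        t + sum_list (map (round_trip G) bs) \<le> 2 * C + tour_bound G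
      else t \<le> C + tour_bound G)"

lemma tour_bound_nonneg: "valid_warehouse G \<Longrightarrow> 0 \<le> tour_bound G"
  using valid_warehouse_bounds[of G] unfolding tour_bound_def by simp

lemma items_known: 
  assumes "sorted (map fst os)" "(j, l) \<in> items os" "fst (os ! j) \<le> t"
  shows "(j, l) \<in> items (known t os)"
proof -
  have j: "j < length os" "l \<in> snd (os ! j)" using assms(2) unfolding items_def by auto
  have "fst (os ! i) \<le> t" if "i < Suc j" for i
    using sorted_nth_mono[OF assms(1), of i j] that j(1) assms(3) by auto
  then have "j < length (known t os)"
    using length_takeWhile_less_P_nth[of "Suc j" "\<lambda>ord. fst ord \<le> t" os] j(1) unfolding known_def by simp
  then show ?thesis using j(2) unfolding items_def known_def by (simp add: takeWhile_nth)
qed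

lemma items_known_subset: "items (known t os) \<subseteq> items os"
  unfolding items_def known_def
  by (auto simp: takeWhile_nth dest: less_le_trans[OF _ length_takeWhile_le])

text \<open>
  At the depot the cart is empty and no batch has to be completed first. So once all orders are
  known, the offline solution restricted to the unserved items bounds the entire plan without an
  additive term.
\<close>

lemma reopt_noninterv_plan:
  assumes rule: "tie_breaking_rule Pcart_N rule" and I: "valid_instance G c os"
    and pl: "fst (rule G c (known t os) (depot_state G t P)) = (cur, fut)"
  defines "bs \<equiv> filter (\<lambda>b. b \<noteq> []) (cur # fut)"
  shows "planned G os (t, P, bs, known t os)"
    and "known t os = os \<Longrightarrow> sum_list (map (round_trip G) bs) \<le> CIOPT Pcart_N G c os"
proof -
  define S where "S = depot_state G t P"
  define ks where "ks = known t os"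
  have G: "valid_warehouse G" using I unfolding valid_instance_def by simp
  note d = valid_warehouse_bounds(5)[OF G]
  have S: "pos S = depot G" "cart S = {}" "picked S = P" unfolding S_def depot_state_def by auto
  have Ik: "valid_instance G c ks" unfolding ks_def by (rule valid_instance_known[OF I])
  have opt: "optimal_plan Pcart_N G c ks S (cur, fut)"
    using tie_breaking_ruleD(1)[OF rule Ik, of S] pl[folded S_def ks_def] d S by simp
  then have feas: "feasible_plan c ks S (cur, fut)" unfolding optimal_plan_def by simp
  have conc: "concat bs = concat (cur # fut)" unfolding bs_def by (rule concat_filter_nonempty)
  have "distinct (concat bs)" "set (concat bs) = items ks - P"
    unfolding conc using feas S(3) unfolding feasible_plan_def by auto
  moreover have "round_trip G b \<le> tour_bound G" if "b \<in> set bs" for b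
    using optimal_plan_round_trip_le[OF Ik opt S(1), of b] that unfolding bs_def by (auto split: if_splits)
  ultimately show "planned G os (t, P, bs, known t os)"
    using items_known_subset unfolding ks_def by (auto simp: bs_def)
  show "sum_list (map (round_trip G) bs) \<le> CIOPT Pcart_N G c os" if "known t os = os"
  proof -
    have ks: "ks = os" using that unfolding ks_def by simp
    have ig: "snd ` items ks \<subseteq> grid G" using items_in_aisles[OF Ik] unfolding grid_def by blast
    have sub: "snd ` set (concat (cur # fut)) \<subseteq> grid G"
      using feas ig unfolding feasible_plan_def by auto
    have z: "round_trip G [] = 0" unfolding round_trip_def using gdist_refl[OF G d] by simp
    have "sum_list (map (round_trip G) (filter (\<lambda>b. b \<noteq> []) zs)) = sum_list (map (round_trip G) zs)" for zs
      by (induction zs) (auto simp: z)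
    then have "sum_list (map (round_trip G) bs) = plan_cost Pcart_N G S (cur, fut)"
      unfolding plan_cost_depot[OF G sub S(1)] bs_def .
    also have "\<dots> \<le> CIOPT Pcart_N G c os"
      using optimal_plan_cost_le[OF I _ _ opt[unfolded ks], of "[]"] S d gdist_refl[OF G d] by simp
    finally show ?thesis .
  qed
qed

lemma nround_invariant:
  assumes rule: "tie_breaking_rule Pcart_N rule" and I: "valid_instance G c os"
    and inv: "planned G os s" "on_time G os (CIOPT Pcart_N G c os) s"
  shows "planned G os (nround rule G c os s) \<and>
    on_time G os (CIOPT Pcart_N G c os) (nround rule G c os s)"
proof -
  obtain t P bs ks where s: "s = (t, P, bs, ks)" by (cases s)
  have G: "valid_warehouse G" using I unfolding valid_instance_def by simp
  note d = valid_warehouse_bounds(5)[OF G]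
  let ?C = "CIOPT Pcart_N G c os"
  show ?thesis
  proof (cases "items os \<subseteq> P")
    case True
    then show ?thesis using inv unfolding s nround_def by simp
  next
    case False
    define R where "R = {fst (os ! j) | j l. (j, l) \<in> items os - P}"
    define t' where "t' = max t (Min R)"
    define ks' where "ks' = known t' os"
    obtain cur fut where pl: "fst (rule G c ks' (depot_state G t' P)) = (cur, fut)" by fastforce
    define bs' where "bs' = (if ks' = ks then bs else filter (\<lambda>b. b \<noteq> []) (cur # fut))"
    define b where "b = hd bs'"
    have R: "R = (\<lambda>x. fst (os ! fst x)) ` (items os - P)" unfolding R_def by force
    have "finite R" "R \<noteq> {}" unfolding R using False I finite_items unfolding valid_instance_def by auto
    then have "Min R \<in> R" by (rule Min_in)
    then obtain j l where jl: "(j, l) \<in> items os - P" "Min R = fst (os ! j)" unfolding R_def by blast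
    have j: "j < length os" using jl(1) unfolding items_def by auto
    have t': "t \<le> t'" "fst (os ! j) \<le> t'" unfolding t'_def jl(2) by auto
    have "(j, l) \<in> items ks'" unfolding ks'_def
      by (rule items_known) (use I jl(1) t' in \<open>auto simp: valid_instance_def valid_orders_def\<close>)
    then have unserved: "items ks' - P \<noteq> {}" using jl(1) by auto
    have planned': "planned G os (t', P, bs', ks')"
      using inv(1) reopt_noninterv_plan(1)[OF rule I pl[unfolded ks'_def], folded ks'_def]
      unfolding bs'_def s by auto
    then have "bs' \<noteq> []" using unserved by auto
    then have bs': "bs' = b # tl bs'" unfolding b_def by simp
    have inP: "snd ` set (concat bs') \<subseteq> grid G"
      using planned' items_in_aisles[OF I] unfolding grid_def by fastforce
    have rt: "round_trip G x \<ge> 0" if "x \<in> set bs'" for x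
      using inP that by (intro round_trip_nonneg[OF G]) auto
    have bb: "b \<in> set bs'" using bs' by (metis list.set_intros(1))
    have b: "0 \<le> round_trip G b" "round_trip G b \<le> tour_bound G" "snd ` set b \<subseteq> grid G"
      using rt[OF bb] planned' inP bb by auto
    have t0: "0 \<le> t'" using inv(2) t'(1) unfolding s by simp
    have next_round: "nround rule G c os s = (t' + round_trip G b, P \<union> set b, tl bs', ks')"
      using False completion_batch_pushcart[OF G _ d b(3) t0, of Pcart_N "[]"]
      unfolding s nround_def prod.case R_def[symmetric] Let_def t'_def[symmetric] ks'_def[symmetric]
        pl bs'_def[symmetric] b_def[symmetric] round_trip_def by simp
    have "planned G os (t' + round_trip G b, P \<union> set b, tl bs', ks')"
    proof -
      have "distinct (concat (b # tl bs'))" "set (concat (b # tl bs')) = items ks' - P"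
        using planned' bs' by auto
      then have "set (concat (tl bs')) = items ks' - (P \<union> set b)" "distinct (concat (tl bs'))" by auto
      moreover have "set (tl bs') \<subseteq> set bs'" using bs' by (metis set_subset_Cons)
      ultimately show ?thesis using planned' by auto
    qed
    moreover have "on_time G os ?C (t' + round_trip G b, P \<union> set b, tl bs', ks')"
    proof (cases "ks' = os")
      case True
      then have arrived: "fst (os ! i) \<le> t'" if "i < length os" for i
        using that unfolding ks'_def known_all by simp
      have "t' + sum_list (map (round_trip G) bs') \<le> 2 * ?C + tour_bound G"
      proof (cases "ks = os")
        \<comment> \<open>All orders were already known, so the picker does not wait and keeps her plan.\<close>
        case True
        then have "t' = t" "bs' = bs"
          using inv(2) \<open>ks' = os\<close> j unfolding s t'_def jl(2) bs'_def by auto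
        then show ?thesis using inv(2) True unfolding s by simp
      next
        case False
        then have "t \<le> ?C + tour_bound G" using inv(2) unfolding s by simp
        then have "t' \<le> ?C + tour_bound G"
          using CIOPT_ge_arrival[OF I j, of Pcart_N] tour_bound_nonneg[OF G] unfolding t'_def jl(2) by simp
        moreover have "sum_list (map (round_trip G) bs') \<le> ?C"
          using reopt_noninterv_plan(2)[OF rule I pl[unfolded ks'_def], folded ks'_def] True False
          unfolding bs'_def by simp
        ultimately show ?thesis by simp
      qed
      moreover have "sum_list (map (round_trip G) bs')
          = round_trip G b + sum_list (map (round_trip G) (tl bs'))"
        by (subst bs') simp
      ultimately show ?thesis using True arrived b(1) t0 by (auto intro: add_increasing2)
    next
      \<comment> \<open>An order is still to arrive after this batch is started, so the batch starts before \<open>C\<close>.\<close>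
      case False
      then obtain i where "i < length os" "t' < fst (os ! i)" unfolding ks'_def known_all by force
      then have "t' < ?C" using CIOPT_ge_arrival[OF I] by (meson less_le_trans)
      then show ?thesis using False b t0 by simp
    qed
    ultimately show ?thesis unfolding next_round by blast
  qed
qed

lemma reopt_noninterv_le:
  assumes rule: "tie_breaking_rule Pcart_N rule" and I: "valid_instance G c os"
  shows "reopt_noninterv rule G c os \<le> 2 * CIOPT Pcart_N G c os + tour_bound G"
proof -
  have G: "valid_warehouse G" using I unfolding valid_instance_def by simp
  let ?C = "CIOPT Pcart_N G c os"
  define s where "s k = (nround rule G c os ^^ k) (0, {}, [], [])" for k
  have C: "0 \<le> ?C" "0 \<le> tour_bound G" using CIOPT_nonneg[OF I] tour_bound_nonneg[OF G] by auto
  have inv: "planned G os (s k) \<and> on_time G os ?C (s k)" for k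
  proof (induction k)
    case 0
    show ?case using C by (auto simp: s_def items_def)
  next
    case (Suc k)
    then show ?case using nround_invariant[OF rule I] by (simp add: s_def)
  qed
  obtain t P bs ks where st: "s (length os) = (t, P, bs, ks)" by (cases "s (length os)")
  have p: "planned G os (t, P, bs, ks)" "on_time G os ?C (t, P, bs, ks)"
    using inv[of "length os"] unfolding st by auto
  have "0 \<le> sum_list (map (round_trip G) bs)"
  proof (rule sum_list_nonneg)
    fix x assume "x \<in> set (map (round_trip G) bs)"
    then obtain b where b: "b \<in> set bs" "x = round_trip G b" by auto
    have "set b \<subseteq> items os" using p(1) b(1) by auto
    then show "0 \<le> x" unfolding b(2) using items_in_aisles[OF I]
      by (intro round_trip_nonneg[OF G]) (auto simp: grid_def)
  qed
  then have "t \<le> 2 * ?C + tour_bound G" using p(2) C by (auto split: if_splits)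
  then show ?thesis using st unfolding reopt_noninterv_def s_def by simp
qed

theorem proposition2:
  fixes sys :: system and rule :: rule
  assumes "tie_breaking_rule sys rule"
  shows "sigma_asymp sys (reopt sys rule) \<le> 2 \<and>
    (\<forall>G c os. valid_instance G c os \<longrightarrow>
       reopt sys rule G c os
         \<le> 2 * CIOPT sys G c os + ((real (aisle_count G) + 1) * width G + 2 * len G))"
proof -
  have bound: "reopt sys rule G c os \<le> 2 * CIOPT sys G c os + tour_bound G"
    if "valid_instance G c os" for G c os
    using reopt_noninterv_le[of rule G c os] reopt_interv_le[OF assms that] assms that
    unfolding reopt_def by auto
  then have "asymp_competitive sys (reopt sys rule) 2"
    unfolding asymp_competitive_def by blast
  then have "sigma_asymp sys (reopt sys rule) \<le> ereal 2"
    unfolding sigma_asymp_def by (intro Inf_lower) blast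
  then show ?thesis using bound unfolding tour_bound_def by simp
qed

end
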